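(* Let $M,N\ge0$ be integers. Let $X_1,\ldots,X_M,Y_1,\ldots,Y_N$ be independent random variables with $X_i\sim N(0,\sigma_{X_i}^2)$ and $Y_j\sim N(0,\sigma_{Y_j}^2)$, let $Z=X/Y$ with $X=X_1\cdots X_M$ and $Y=Y_1\cdots Y_N$, and let $f_Z$ be the probability density function of $Z$. (i) Suppose $M\ge1$, $N\ge0$. Then, as $z\to0$, $$f_Z(z)\sim\frac{2^{(M+N-2)/2}s_N}{\pi^{(M+N)/2}\sigma_M}\,\frac{(-\ln|z|)^{M-1}}{(M-1)!}.$$ (ii) Suppose $M=0$, $N\ge1$. Then, as $z\to0$, $$f_Z(z)\sim\frac{2^{(N-2)/2}}{\sqrt{N\pi}\,s_N^{1/N}}\,|z|^{-(N+1)/N}\exp\bigg(-\frac{N}{2(s_N|z|)^{2/N}}\bigg).$$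
   Context: All standard deviations $\sigma_{X_i},\sigma_{Y_j}$ are positive. Notation: $\sigma_M=\sigma_{X_1}\cdots\sigma_{X_M}$ and $s_N=\sigma_{Y_1}\cdots\sigma_{Y_N}$. Empty products are $1$: thus $\sigma_0=1$, $s_0=1$, $X=1$ when $M=0$, and $Y=1$ when $N=0$. The density $f_Z$ is taken to be the version that is continuous on $\mathbb{R}\setminus\{0\}$. The notation $f\sim g$ means that the ratio $f/g$ tends to $1$ in the stated limit (here $z\to0$ with $z\ne0$). *)

theory Defs
  imports "HOL-Probability.Probability" "HOL-Library.Landau_Symbols"
begin

text \<open>
  Conventions. The mutual independence of the joint family
  \<open>X 1, ..., X M, Y 1, ..., Y N\<close> is that of the family \<open>case_sum X Y\<close> over the
  disjoint sum of the two index sets; either index set may be empty. The quotient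
  of the products is given by real division, so it is \<open>0\<close> on the null event where
  the denominator vanishes. A probability density is determined only almost
  everywhere; requiring continuity away from \<open>0\<close> fixes all its values relevant to
  the limit at the punctured point \<open>0\<close> (the filter \<open>at 0\<close>).
\<close>

end

theory Submission
  imports Defs "HOL-Real_Asymp.Real_Asymp"
begin

text \<open>
  After dividing each variable by its standard deviation, condition on all factors but one standard
  normal numerator \<open>U\<close>: a product \<open>U V\<close> has the continuous density \<open>E (\<phi> (y / V) / \<bar>V\<bar>)\<close>. For a single
  numerator (\<open>V = 1 / Y\<close>) the value at \<open>0\<close> is \<open>\<phi> 0 * E \<bar>Y\<bar>\<close>, and each further numerator
  acts on the density, in the variable \<open>ln \<bar>y\<bar>\<close>, by convolution with \<open>2 \<phi> (exp L)\<close>. This kernel tends to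
  \<open>2 \<phi> 0\<close> at minus infinity and vanishes doubly exponentially at plus infinity, so near
  the origin each convolution integrates the power of \<open>- ln \<bar>z\<bar>\<close> once. For \<open>M = 0\<close> the density of
  \<open>1 / Y\<close> at \<open>z\<close> is that of \<open>Y\<close> at \<open>1 / z\<close> divided by \<open>z\<^sup>2\<close>, and the same convolution is evaluated at
  infinity by Laplace's method, one factor at a time.
\<close>

section \<open>Logarithmic coordinates and the standard normal density\<close>

text \<open>Each convolution step uses only the leading behaviour of a density at one end of the
  logarithmic line and its finite mass, the integral of \<open>exp s * G s\<close>. Where no
  asymptotics is known, mass alone gives the estimate, so the induction carries no uniform control
  of the iterates. Denominators enter the limit at the origin only through
  \<open>E \<bar>Y\<bar>\<close>. For a standard normal \<open>U\<close>,
  \<open>E \<bar>U\<bar> = 2 * \<phi> 0 = sqrt (2 / \<pi>)\<close>, so numerators and denominators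
  contribute the same constant; only the first numerator lacks the factor 2, whence the exponent
  \<open>M + N - 2\<close>. With no numerator the density vanishes at the origin, and its size there
  is the tail of \<open>Y\<close>. The Laplace step is closed under iteration: minimising the phase
  reproduces a profile of the same form with \<open>n + 1\<close> for \<open>n\<close>, and the
  factors \<open>sqrt (2 n / (n + 1))\<close> telescope. Continuity matters throughout: it turns
  almost everywhere uniqueness of densities into equality at every nonzero point, without which a
  pointwise limit could not be transferred to the given density.\<close>

lemma nn_integral_exp_substitution:
  fixes f :: "real \<Rightarrow> ennreal"
  assumes [measurable]: "f \<in> borel_measurable borel"
  shows "(\<integral>\<^sup>+x. f x * indicator {0<..} x \<partial>lborel) = (\<integral>\<^sup>+s. f (exp s) * ennreal (exp s) \<partial>lborel)"
proof -
  have eq: "(\<integral>\<^sup>+x. f x * indicator {exp (- real (Suc n))..exp (real (Suc n))} x \<partial>lborel) =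
      (\<integral>\<^sup>+s. f (exp s) * ennreal (exp s) * indicator {- real (Suc n)..real (Suc n)} s \<partial>lborel)" for n
    by (rule nn_integral_substitution_aux) (auto intro!: derivative_eq_intros continuous_intros)
  \<comment> \<open>The compact intervals increase to the half line, and their logarithms to the
    whole line, so monotone convergence applies to both sides of \<open>eq\<close>.\<close>
  have 1: "(\<lambda>n. \<integral>\<^sup>+x. f x * indicator {exp (- real (Suc n))..exp (real (Suc n))} x \<partial>lborel)
      \<longlonglongrightarrow> (\<integral>\<^sup>+x. f x * indicator {0<..} x \<partial>lborel)"
  proof (rule nn_integral_LIMSEQ)
    show "incseq (\<lambda>n x. f x * indicator {exp (- real (Suc n))..exp (real (Suc n))} x)"
      by (auto simp: incseq_def le_fun_def indicator_def intro: order_trans[rotated] order_trans)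
    show "(\<lambda>n. f x * indicator {exp (- real (Suc n))..exp (real (Suc n))} x)
        \<longlonglongrightarrow> f x * indicator {0<..} x" for x
    proof (cases "x > 0")
      case True
      have "eventually (\<lambda>n. real (Suc n) \<ge> \<bar>ln x\<bar>) sequentially"
        by real_asymp
      then have "eventually (\<lambda>n. f x * indicator {exp (- real (Suc n))..exp (real (Suc n))} x
          = f x * indicator {0<..} x) sequentially"
      proof eventually_elim
        case (elim n)
        then have "exp (- real (Suc n)) \<le> exp (ln x)" "exp (ln x) \<le> exp (real (Suc n))"
          unfolding exp_le_cancel_iff by linarith+
        then show ?case using True by (simp add: indicator_def)
      qed
      then show ?thesis by (rule tendsto_eventually)
    next
      case False
      then have "x < exp (- real (Suc n))" for n
        by (meson exp_gt_zero le_less_trans not_less)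
      then have "f x * indicator {exp (- real (Suc n))..exp (real (Suc n))} x = f x * indicator {0<..} x" for n
        using False by (simp add: indicator_def not_le[symmetric])
      then show ?thesis by simp
    qed
  qed simp
  have 2: "(\<lambda>n. \<integral>\<^sup>+s. f (exp s) * ennreal (exp s) * indicator {- real (Suc n)..real (Suc n)} s \<partial>lborel)
      \<longlonglongrightarrow> (\<integral>\<^sup>+s. f (exp s) * ennreal (exp s) \<partial>lborel)"
  proof (rule nn_integral_LIMSEQ)
    show "incseq (\<lambda>n s. f (exp s) * ennreal (exp s) * indicator {- real (Suc n)..real (Suc n)} s)"
      by (auto simp: incseq_def le_fun_def indicator_def)
    show "(\<lambda>n. f (exp s) * ennreal (exp s) * indicator {- real (Suc n)..real (Suc n)} s)
        \<longlonglongrightarrow> f (exp s) * ennreal (exp s)" for s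
    proof -
      have "eventually (\<lambda>n. real (Suc n) \<ge> \<bar>s\<bar>) sequentially"
        by real_asymp
      then have "eventually (\<lambda>n. f (exp s) * ennreal (exp s) * indicator {- real (Suc n)..real (Suc n)} s
          = f (exp s) * ennreal (exp s)) sequentially"
        by eventually_elim (auto simp: indicator_def)
      then show ?thesis by (rule tendsto_eventually)
    qed
  qed simp
  show ?thesis
    using 1 2 unfolding eq by (rule LIMSEQ_unique)
qed

text \<open>The point 0 is null and reflection folds the negative half line onto the positive one.
  The two sign branches are the source of the factor 2 in all later logarithmic formulas for even
  densities.\<close>

lemma nn_integral_lborel_exp:
  fixes f :: "real \<Rightarrow> ennreal"
  assumes [measurable]: "f \<in> borel_measurable borel"
  shows "(\<integral>\<^sup>+x. f x \<partial>lborel) = (\<integral>\<^sup>+s. (f (exp s) + f (- exp s)) * ennreal (exp s) \<partial>lborel)"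
proof -
  have "(\<integral>\<^sup>+x. f x \<partial>lborel) = (\<integral>\<^sup>+x. f x * indicator {0<..} x + f x * indicator {..<0} x \<partial>lborel)"
    by (rule nn_integral_cong_AE, rule AE_mp[OF AE_lborel_singleton[of 0]]) (auto simp: indicator_def)
  also have "\<dots> = (\<integral>\<^sup>+x. f x * indicator {0<..} x \<partial>lborel) + (\<integral>\<^sup>+x. f x * indicator {..<0} x \<partial>lborel)"
    by (rule nn_integral_add) auto
  also have "(\<integral>\<^sup>+x. f x * indicator {..<0} x \<partial>lborel) = (\<integral>\<^sup>+x. f (- x) * indicator {0<..} x \<partial>lborel)"
    by (subst nn_integral_real_affine[where c="-1" and t=0])
       (auto simp: indicator_def intro!: nn_integral_cong)
  also have "(\<integral>\<^sup>+x. f x * indicator {0<..} x \<partial>lborel) + \<dots> =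
      (\<integral>\<^sup>+s. f (exp s) * ennreal (exp s) \<partial>lborel) + (\<integral>\<^sup>+s. f (- exp s) * ennreal (exp s) \<partial>lborel)"
    by (subst (1 2) nn_integral_exp_substitution) auto
  also have "\<dots> = (\<integral>\<^sup>+s. f (exp s) * ennreal (exp s) + f (- exp s) * ennreal (exp s) \<partial>lborel)"
    by (rule nn_integral_add[symmetric]) auto
  finally show ?thesis by (simp add: distrib_right)
qed

lemma std_normal_density_0: "std_normal_density 0 = 1 / sqrt (2 * pi)"
  by (simp add: std_normal_density_def)

lemma inverse_sqrt_2pi_le_1: "1 / sqrt (2 * pi) \<le> 1"
proof -
  have "1 \<le> 2 * pi" using pi_ge_two by linarith
  then show ?thesis by (simp add: real_le_rsqrt)
qed

lemma std_normal_density_le_1: "std_normal_density x \<le> 1"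
  using mult_mono[OF inverse_sqrt_2pi_le_1, of "exp (- x\<^sup>2 / 2)" 1]
  by (simp add: std_normal_density_def)

text \<open>From \<open>x \<le> exp (x\<^sup>2 / 4)\<close>, which also leaves a Gaussian factor to spare.\<close>

lemma abs_times_std_normal_density_le:
  "\<bar>x\<bar> * std_normal_density x \<le> exp (- x\<^sup>2 / 4)"
proof -
  have "\<bar>x\<bar> \<le> 1 + x\<^sup>2 / 4"
    using zero_le_power2[of "\<bar>x\<bar> / 2 - 1"] by (simp add: power2_eq_square algebra_simps)
  also have "\<dots> \<le> exp (x\<^sup>2 / 4)" by (rule exp_ge_add_one_self)
  finally have "\<bar>x\<bar> * exp (- x\<^sup>2 / 2) \<le> exp (x\<^sup>2 / 4) * exp (- x\<^sup>2 / 2)"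
    by (intro mult_right_mono) auto
  also have "\<dots> = exp (- x\<^sup>2 / 4)" by (simp add: exp_add[symmetric])
  finally have "1 / sqrt (2 * pi) * (\<bar>x\<bar> * exp (- x\<^sup>2 / 2)) \<le> 1 * exp (- x\<^sup>2 / 4)"
    by (intro mult_mono inverse_sqrt_2pi_le_1) auto
  then show ?thesis by (simp add: std_normal_density_def mult_ac)
qed

text \<open>At \<open>x = exp (L - s)\<close> this crude tail bound is a multiple of
  \<open>exp s\<close>, exactly the weight against which a density in logarithmic coordinates is
  integrable.\<close>

lemma std_normal_density_le_inverse:
  assumes "x > 0"
  shows "std_normal_density x \<le> 1 / x"
  using order_trans[OF abs_times_std_normal_density_le[of x], of 1] assms
  by (simp add: field_simps)

lemma tendsto_std_normal_density [tendsto_intros]: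
  "(f \<longlongrightarrow> l) F \<Longrightarrow> ((\<lambda>x. std_normal_density (f x)) \<longlongrightarrow> std_normal_density l) F"
  unfolding std_normal_density_def by (auto intro!: tendsto_intros)

section \<open>Densities of products\<close>

context prob_space
begin

text \<open>The value at \<open>\<bar>y\<bar> = exp L\<close> of the density of \<open>U V\<close> for a standard normal \<open>U\<close> independent of \<open>V\<close>.\<close>

definition normal_mixture :: "('a \<Rightarrow> real) \<Rightarrow> real \<Rightarrow> real"
  where "normal_mixture V L = expectation (\<lambda>\<omega>. std_normal_density (exp L / V \<omega>) / \<bar>V \<omega>\<bar>)"

text \<open>Bounding \<open>u * \<phi> u\<close> by 1 at \<open>u = exp L / \<bar>v\<bar>\<close>
  removes \<open>v\<close> altogether, so the mixture is finite without any moment of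
  \<open>V\<close>. At \<open>v = 0\<close> the quotient is 0 by convention.\<close>

lemma normal_mixture_bound:
  "std_normal_density (exp L / v) / \<bar>v\<bar> \<le> exp (- L)"
proof (cases "v = 0")
  case False
  have "\<bar>exp L / v\<bar> * std_normal_density (exp L / v) \<le> 1"
    by (rule order_trans[OF abs_times_std_normal_density_le]) simp
  then show ?thesis using False by (simp add: exp_minus field_simps)
qed simp

lemma normal_mixture_integrable:
  assumes [measurable]: "random_variable borel V"
  shows "integrable M (\<lambda>\<omega>. std_normal_density (exp L / V \<omega>) / \<bar>V \<omega>\<bar>)"
  using normal_mixture_bound by (intro integrable_const_bound[where B="exp (- L)"]) auto

lemma normal_mixture_nonneg: "normal_mixture V L \<ge> 0"
  unfolding normal_mixture_def by simp

text \<open>A convergent sequence is bounded, which makes the bound \<open>exp (- L)\<close> a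
  constant majorant along it.\<close>

lemma continuous_normal_mixture:
  assumes [measurable]: "random_variable borel V"
  shows "continuous_on UNIV (normal_mixture V)"
proof (rule continuous_at_imp_continuous_on, rule ballI)
  fix L :: real
  show "isCont (normal_mixture V) L"
    unfolding continuous_at_sequentially
  proof safe
    fix x assume x: "x \<longlonglongrightarrow> L"
    have "Bseq x"
      using x by (intro convergent_imp_Bseq convergentI)
    then obtain B where B: "\<And>n. \<bar>x n\<bar> \<le> B"
      by (metis BseqE real_norm_def)
    show "(normal_mixture V \<circ> x) \<longlonglongrightarrow> normal_mixture V L"
      unfolding normal_mixture_def comp_def
    proof (rule integral_dominated_convergence[where w="\<lambda>_. exp B"])
      show "AE \<omega> in M. (\<lambda>n. std_normal_density (exp (x n) / V \<omega>) / \<bar>V \<omega>\<bar>)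
          \<longlonglongrightarrow> std_normal_density (exp L / V \<omega>) / \<bar>V \<omega>\<bar>"
      proof (rule AE_I2)
        fix \<omega> show "(\<lambda>n. std_normal_density (exp (x n) / V \<omega>) / \<bar>V \<omega>\<bar>)
          \<longlonglongrightarrow> std_normal_density (exp L / V \<omega>) / \<bar>V \<omega>\<bar>"
          using x by (cases "V \<omega> = 0") (auto intro!: tendsto_intros)
      qed
      show "AE \<omega> in M. norm (std_normal_density (exp (x n) / V \<omega>) / \<bar>V \<omega>\<bar>) \<le> exp B" for n
        using B[of n] by (auto intro!: AE_I2 order_trans[OF normal_mixture_bound])
    qed auto
  qed
qed

text \<open>Conditionally on \<open>V\<close>, the substitution \<open>y = V u\<close> turns the law
  of \<open>U\<close> into a density in \<open>y\<close>, and Fubini averages it over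
  \<open>V\<close>. Since \<open>\<phi>\<close> is even, only \<open>\<bar>y\<bar>\<close> matters.
  The event \<open>V = 0\<close> would put an atom at the origin.\<close>

lemma distributed_normal_times:
  assumes U: "distributed M lborel U std_normal_density"
    and ind: "indep_var borel U borel V" and nz: "AE \<omega> in M. V \<omega> \<noteq> 0"
  shows "distributed M lborel (\<lambda>\<omega>. U \<omega> * V \<omega>) (\<lambda>y. ennreal (normal_mixture V (ln \<bar>y\<bar>)))"
proof -
  have [measurable]: "random_variable borel U" "random_variable borel V"
    using ind by (auto dest: indep_var_rv1 indep_var_rv2)
  have [measurable]: "normal_mixture V \<in> borel_measurable borel"
    by (rule borel_measurable_continuous_onI[OF continuous_normal_mixture]) simp
  interpret DV: prob_space "distr M borel V" by (rule prob_space_distr) simp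
  interpret DU: prob_space "distr M borel U" by (rule prob_space_distr) simp
  interpret UV: pair_sigma_finite "distr M borel U" "distr M borel V" ..
  interpret LM: pair_sigma_finite lborel M ..
  have DU: "distr M borel U = density lborel (\<lambda>x. ennreal (std_normal_density x))"
  proof -
    have "distr M borel U = distr M lborel U" by (rule distr_cong) auto
    then show ?thesis using U by (simp add: distributed_def)
  qed
  have D: "distr M borel U \<Otimes>\<^sub>M distr M borel V = distr M (borel \<Otimes>\<^sub>M borel) (\<lambda>\<omega>. (U \<omega>, V \<omega>))"
    using ind by (simp add: indep_var_distribution_eq)
  show ?thesis
    unfolding distributed_def
  proof safe
    show "distr M lborel (\<lambda>\<omega>. U \<omega> * V \<omega>) = density lborel (\<lambda>y. ennreal (normal_mixture V (ln \<bar>y\<bar>)))"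
    proof (rule measure_eqI)
      fix A assume "A \<in> sets (distr M lborel (\<lambda>\<omega>. U \<omega> * V \<omega>))"
      then have [measurable]: "A \<in> sets borel" by simp
      have "emeasure (distr M lborel (\<lambda>\<omega>. U \<omega> * V \<omega>)) A = (\<integral>\<^sup>+\<omega>. indicator A (U \<omega> * V \<omega>) \<partial>M)"
        by (subst nn_integral_indicator[symmetric], simp, subst nn_integral_distr) auto
      also have "\<dots> = (\<integral>\<^sup>+z. indicator A (fst z * snd z) \<partial>(distr M borel U \<Otimes>\<^sub>M distr M borel V))"
        unfolding D by (subst nn_integral_distr) auto
      also have "\<dots> = (\<integral>\<^sup>+v. \<integral>\<^sup>+u. indicator A (u * v) \<partial>distr M borel U \<partial>distr M borel V)"
        by (subst UV.nn_integral_snd[symmetric]) auto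
      also have "\<dots> = (\<integral>\<^sup>+\<omega>. \<integral>\<^sup>+u. indicator A (u * V \<omega>) \<partial>distr M borel U \<partial>M)"
        by (subst nn_integral_distr) (auto intro!: DU.borel_measurable_nn_integral)
      also have "\<dots> = (\<integral>\<^sup>+\<omega>. \<integral>\<^sup>+y. ennreal (std_normal_density (\<bar>y\<bar> / V \<omega>) / \<bar>V \<omega>\<bar>) * indicator A y \<partial>lborel \<partial>M)"
      proof (rule nn_integral_cong_AE, use nz in eventually_elim)
        fix \<omega> assume nz: "V \<omega> \<noteq> 0"
        have "(\<integral>\<^sup>+y. ennreal (std_normal_density (\<bar>y\<bar> / V \<omega>) / \<bar>V \<omega>\<bar>) * indicator A y \<partial>lborel)
          = \<bar>V \<omega>\<bar> * (\<integral>\<^sup>+u. ennreal (std_normal_density (\<bar>V \<omega> * u\<bar> / V \<omega>) / \<bar>V \<omega>\<bar>) * indicator A (V \<omega> * u) \<partial>lborel)"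
          by (subst nn_integral_real_affine[where c="V \<omega>" and t=0]) (use nz in auto)
        also have "\<dots> = (\<integral>\<^sup>+u. ennreal \<bar>V \<omega>\<bar> * (ennreal (std_normal_density (\<bar>V \<omega> * u\<bar> / V \<omega>) / \<bar>V \<omega>\<bar>) * indicator A (V \<omega> * u)) \<partial>lborel)"
          by (rule nn_integral_cmult[symmetric]) simp
        also have "\<dots> = (\<integral>\<^sup>+u. ennreal (std_normal_density u) * indicator A (u * V \<omega>) \<partial>lborel)"
        proof (rule nn_integral_cong)
          fix u
          have "std_normal_density (\<bar>V \<omega> * u\<bar> / V \<omega>) = std_normal_density u"
            using nz by (auto simp: std_normal_density_def power_divide power_mult_distrib)
          then have "ennreal \<bar>V \<omega>\<bar> * ennreal (std_normal_density (\<bar>V \<omega> * u\<bar> / V \<omega>) / \<bar>V \<omega>\<bar>) = ennreal (std_normal_density u)"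
            using nz by (simp add: ennreal_mult'[symmetric])
          then show "ennreal \<bar>V \<omega>\<bar> * (ennreal (std_normal_density (\<bar>V \<omega> * u\<bar> / V \<omega>) / \<bar>V \<omega>\<bar>) * indicator A (V \<omega> * u)) =
             ennreal (std_normal_density u) * indicator A (u * V \<omega>)"
            by (simp add: mult.assoc[symmetric] mult.commute[of u])
        qed
        also have "\<dots> = (\<integral>\<^sup>+u. indicator A (u * V \<omega>) \<partial>distr M borel U)"
          unfolding DU by (subst nn_integral_density) auto
        finally show "(\<integral>\<^sup>+u. indicator A (u * V \<omega>) \<partial>distr M borel U) =
          (\<integral>\<^sup>+y. ennreal (std_normal_density (\<bar>y\<bar> / V \<omega>) / \<bar>V \<omega>\<bar>) * indicator A y \<partial>lborel)" by simp
      qed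
      also have "\<dots> = (\<integral>\<^sup>+y. \<integral>\<^sup>+\<omega>. ennreal (std_normal_density (\<bar>y\<bar> / V \<omega>) / \<bar>V \<omega>\<bar>) * indicator A y \<partial>M \<partial>lborel)"
        by (rule LM.Fubini') measurable
      also have "\<dots> = (\<integral>\<^sup>+y. ennreal (normal_mixture V (ln \<bar>y\<bar>)) * indicator A y \<partial>lborel)"
      \<comment> \<open>The origin is discarded because
        \<open>exp (ln \<bar>y\<bar>) = \<bar>y\<bar>\<close> fails there.\<close>
      proof (rule nn_integral_cong_AE, rule AE_mp[OF AE_lborel_singleton[of 0]], intro AE_I2 impI)
        fix y :: real assume "y \<noteq> 0"
        have "exp (ln \<bar>y\<bar>) = \<bar>y\<bar>" using \<open>y \<noteq> 0\<close> by simp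
        have "(\<integral>\<^sup>+\<omega>. ennreal (std_normal_density (exp (ln \<bar>y\<bar>) / V \<omega>) / \<bar>V \<omega>\<bar>) \<partial>M) = ennreal (normal_mixture V (ln \<bar>y\<bar>))"
          unfolding normal_mixture_def
          by (intro nn_integral_eq_integral normal_mixture_integrable AE_I2) auto
        then have "(\<integral>\<^sup>+\<omega>. ennreal (std_normal_density (\<bar>y\<bar> / V \<omega>) / \<bar>V \<omega>\<bar>) \<partial>M) = ennreal (normal_mixture V (ln \<bar>y\<bar>))"
          by (simp only: \<open>exp (ln \<bar>y\<bar>) = \<bar>y\<bar>\<close>)
        then show "(\<integral>\<^sup>+\<omega>. ennreal (std_normal_density (\<bar>y\<bar> / V \<omega>) / \<bar>V \<omega>\<bar>) * indicator A y \<partial>M) =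
            ennreal (normal_mixture V (ln \<bar>y\<bar>)) * indicator A y"
          by (subst nn_integral_multc) auto
      qed
      finally show "emeasure (distr M lborel (\<lambda>\<omega>. U \<omega> * V \<omega>)) A =
          emeasure (density lborel (\<lambda>y. ennreal (normal_mixture V (ln \<bar>y\<bar>)))) A"
        by (simp add: emeasure_density)
    qed simp
  qed simp_all
qed

end

section \<open>Logarithmic growth at the origin\<close>

text \<open>If \<open>V\<close> has density \<open>v \<mapsto> G (ln \<bar>v\<bar>)\<close>, then \<open>U V\<close> has density \<open>y \<mapsto> normal_conv G (ln \<bar>y\<bar>)\<close>:
  the multiplicative convolution becomes additive in the logarithmic coordinate.\<close>

definition normal_conv :: "(real \<Rightarrow> real) \<Rightarrow> real \<Rightarrow> real"
  where "normal_conv G L = 2 * (\<integral>s. std_normal_density (exp (L - s)) * G s \<partial>lborel)"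

text \<open>The kernel is at most \<open>exp (s - L)\<close>, so finite total mass suffices for
  every \<open>L\<close>.\<close>

lemma normal_conv_integrable:
  assumes [measurable]: "G \<in> borel_measurable borel" and int: "integrable lborel (\<lambda>s. exp s * G s)"
  shows "integrable lborel (\<lambda>s. std_normal_density (exp (L - s)) * G s)"
proof (rule Bochner_Integration.integrable_bound)
  show "integrable lborel (\<lambda>s. exp (- L) * (exp s * G s))" using int by simp
  show "AE s in lborel. norm (std_normal_density (exp (L - s)) * G s) \<le> norm (exp (- L) * (exp s * G s))"
  proof (rule AE_I2)
    fix s
    have "std_normal_density (exp (L - s)) * \<bar>G s\<bar> \<le> (exp (- L) * exp s) * \<bar>G s\<bar>"
      using std_normal_density_le_inverse[of "exp (L - s)"]
      by (intro mult_right_mono) (auto simp: exp_minus exp_diff field_simps)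
    then show "norm (std_normal_density (exp (L - s)) * G s) \<le> norm (exp (- L) * (exp s * G s))"
      by (simp add: abs_mult mult_ac)
  qed
qed simp

text \<open>Meant for \<open>A\<close> a half line on which the asymptotics of \<open>G\<close> is
  in force; on the complement only the total mass of \<open>G\<close> is available.\<close>

lemma normal_conv_split:
  assumes [measurable]: "G \<in> borel_measurable borel" "A \<in> sets borel"
    and int: "integrable lborel (\<lambda>s. exp s * G s)"
  shows "normal_conv G L = 2 * (\<integral>s. std_normal_density (exp (L - s)) * (G s * indicator A s) \<partial>lborel)
    + 2 * (\<integral>s. std_normal_density (exp (L - s)) * (G s * indicator (- A) s) \<partial>lborel)"
proof -
  have 1: "integrable lborel (\<lambda>s. std_normal_density (exp (L - s)) * (G s * indicator B s))"
    if [measurable]: "B \<in> sets borel" for B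
    using integrable_mult_indicator[OF _ normal_conv_integrable[OF assms(1) int, of L], of B]
    by (simp add: mult_ac)
  have "(\<integral>s. std_normal_density (exp (L - s)) * G s \<partial>lborel) =
    (\<integral>s. std_normal_density (exp (L - s)) * (G s * indicator A s)
        + std_normal_density (exp (L - s)) * (G s * indicator (- A) s) \<partial>lborel)"
    by (rule Bochner_Integration.integral_cong) (auto simp: indicator_def)
  also have "\<dots> = (\<integral>s. std_normal_density (exp (L - s)) * (G s * indicator A s) \<partial>lborel)
     + (\<integral>s. std_normal_density (exp (L - s)) * (G s * indicator (- A) s) \<partial>lborel)"
    by (intro Bochner_Integration.integral_add 1) auto
  finally show ?thesis by (simp add: normal_conv_def)
qed

lemma eventually_bound_of_ratio_tendsto:
  fixes f g :: "real \<Rightarrow> real"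
  assumes "((\<lambda>x. f x / g x) \<longlongrightarrow> c) at_top" "eventually (\<lambda>x. g x > 0) at_top"
  shows "eventually (\<lambda>x. f x \<le> (\<bar>c\<bar> + 1) * g x) at_top"
proof -
  have "eventually (\<lambda>x. f x / g x < \<bar>c\<bar> + 1) at_top"
    by (rule order_tendstoD[OF assms(1)]) simp
  with assms(2) show ?thesis
    by eventually_elim (simp add: field_simps)
qed

text \<open>Rescaling \<open>s = - x t\<close>, the kernel at \<open>- x\<close> tends to the constant \<open>\<phi> 0\<close> for \<open>t < 1\<close> and to \<open>0\<close> for \<open>t > 1\<close>,
  so the limit is \<open>2 \<phi> 0 c\<close> times the integral of \<open>t ^ k\<close> over the unit interval.\<close>

lemma normal_conv_log_power:
  assumes [measurable]: "G \<in> borel_measurable borel" and nonneg: "\<And>s. G s \<ge> 0"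
    and int: "integrable lborel (\<lambda>s. exp s * G s)"
    and lim: "((\<lambda>x. G (- x) / x ^ k) \<longlongrightarrow> c) at_top"
  shows "((\<lambda>x. normal_conv G (- x) / x ^ Suc k)
    \<longlongrightarrow> 2 * std_normal_density 0 * c / real (Suc k)) at_top"
proof -
  define C where "C = \<bar>c\<bar> + 1"
  have "C > 0" by (simp add: C_def)
  have "eventually (\<lambda>x. G (- x) \<le> C * x ^ k) at_top"
    unfolding C_def by (rule eventually_bound_of_ratio_tendsto[OF lim])
      (use eventually_gt_at_top[of 0] in eventually_elim, simp)
  with eventually_gt_at_top[of 0] have "eventually (\<lambda>x. x > 0 \<and> G (- x) \<le> C * x ^ k) at_top"
    by eventually_elim simp
  then obtain b where "\<And>x. x \<ge> b \<Longrightarrow> x > 0 \<and> G (- x) \<le> C * x ^ k"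
    by (auto simp: eventually_at_top_linorder)
  then have b0: "b > 0" and b: "\<And>x. x \<ge> b \<Longrightarrow> G (- x) \<le> C * x ^ k" by auto
  let ?A = "{..- b}"
  \<comment> \<open>For \<open>s > - b\<close> one has \<open>1 \<le> exp (b + s)\<close>, so the
    remaining part of the integral is bounded by \<open>D\<close> uniformly in \<open>x\<close> and
    is lost after division by \<open>x ^ Suc k\<close>.\<close>
  define D where "D = exp b * (\<integral>s. exp s * G s \<partial>lborel)"
  define I1 where "I1 x = (\<integral>s. std_normal_density (exp (- x - s)) * (G s * indicator ?A s) \<partial>lborel)" for x
  define I2 where "I2 x = (\<integral>s. std_normal_density (exp (- x - s)) * (G s * indicator (- ?A) s) \<partial>lborel)" for x
  have I2: "0 \<le> I2 x" "I2 x \<le> D" for x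
  proof -
    show "0 \<le> I2 x" unfolding I2_def using nonneg by (intro integral_nonneg_AE AE_I2) auto
    have "I2 x \<le> (\<integral>s. exp b * (exp s * G s) \<partial>lborel)"
      unfolding I2_def
    proof (rule integral_mono')
      show "integrable lborel (\<lambda>s. exp b * (exp s * G s))" using int by simp
      fix s show "std_normal_density (exp (- x - s)) * (G s * indicator (- ?A) s) \<le> exp b * (exp s * G s)"
      proof (cases "s \<in> ?A")
        case False
        then have "1 \<le> exp (b + s)" by simp
        then have "std_normal_density (exp (- x - s)) * G s \<le> exp (b + s) * G s"
          using std_normal_density_le_1[of "exp (- x - s)"] by (intro mult_right_mono nonneg) linarith
        then show ?thesis using False by (simp add: exp_add)
      qed (use nonneg in simp)
      show "0 \<le> exp b * (exp s * G s)" using nonneg by simp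
    qed
    then show "I2 x \<le> D" by (simp add: D_def)
  qed
  have lim2: "((\<lambda>x. I2 x / x ^ Suc k) \<longlongrightarrow> 0) at_top"
  proof (rule tendsto_sandwich)
    show "((\<lambda>x. 0) \<longlongrightarrow> (0::real)) at_top" by simp
    show "((\<lambda>x. D / x ^ Suc k) \<longlongrightarrow> 0) at_top"
      by (intro tendsto_divide_0[OF tendsto_const] filterlim_at_top_imp_at_infinity
          filterlim_pow_at_top filterlim_ident) auto
    show "eventually (\<lambda>x. 0 \<le> I2 x / x ^ Suc k) at_top"
      using eventually_gt_at_top[of 0] by eventually_elim (use I2 in simp)
    show "eventually (\<lambda>x. I2 x / x ^ Suc k \<le> D / x ^ Suc k) at_top"
      using eventually_gt_at_top[of 0] by eventually_elim (use I2 in \<open>simp add: divide_right_mono\<close>)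
  qed
  \<comment> \<open>The Jacobian \<open>x\<close> of \<open>s = - x t\<close> and the
    \<open>x ^ k\<close> divided out here make up \<open>x ^ Suc k\<close>.\<close>
  define h where "h x t = std_normal_density (exp (x * (t - 1))) * (G (- (x * t)) * indicator ?A (- (x * t)) / x ^ k)"
    for x t :: real
  have I1: "I1 x / x ^ Suc k = (\<integral>t. h x t \<partial>lborel)" if "x > 0" for x
  proof -
    have "I1 x = x * (\<integral>t. std_normal_density (exp (x * (t - 1))) * (G (- (x * t)) * indicator ?A (- (x * t))) \<partial>lborel)"
      unfolding I1_def using that
      by (subst lborel_integral_real_affine[where c="- x" and t=0]) (simp_all add: algebra_simps)
    also have "(\<integral>t. std_normal_density (exp (x * (t - 1))) * (G (- (x * t)) * indicator ?A (- (x * t))) \<partial>lborel)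
        = (\<integral>t. x ^ k * h x t \<partial>lborel)"
      using that by (intro Bochner_Integration.integral_cong) (auto simp: h_def)
    finally show ?thesis using that by simp
  qed
  have lim1: "((\<lambda>x. \<integral>t. h x t \<partial>lborel) \<longlongrightarrow>
      (\<integral>t. std_normal_density 0 * c * (t ^ k * indicator {0<..<1} t) \<partial>lborel)) at_top"
  proof (rule integral_dominated_convergence_at_top)
    \<comment> \<open>For \<open>x \<ge> 1\<close> and \<open>t > 0\<close> the kernel is below
      \<open>exp (1 - t)\<close> on both sides of \<open>t = 1\<close>: by boundedness on the left,
      by the inverse tail bound on the right. This is the origin of \<open>exp 1\<close>.\<close>
    show "integrable lborel (\<lambda>t. C * exp 1 * (t ^ k * exp (- t) * indicator {0..} t))"
    proof (intro integrable_mult_right integrableI_nonneg)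
      show "AE t in lborel. 0 \<le> t ^ k * exp (- t) * indicator {0..} (t::real)"
        by (auto simp: indicator_def)
      have "(\<integral>\<^sup>+t. ennreal (t ^ k * exp (- t) * indicator {0..} (t::real)) \<partial>lborel) = ennreal (real (fact k))"
        unfolding nn_intergal_power_times_exp_Ici[symmetric]
        by (intro nn_integral_cong) (auto simp: indicator_def)
      then show "(\<integral>\<^sup>+t. ennreal (t ^ k * exp (- t) * indicator {0..} (t::real)) \<partial>lborel) < \<infinity>"
        by simp
    qed simp
    show "\<forall>\<^sub>F x in at_top. AE t in lborel. norm (h x t) \<le> C * exp 1 * (t ^ k * exp (- t) * indicator {0..} t)"
      using eventually_ge_at_top[of 1]
    proof (eventually_elim, intro AE_I2)
      fix x t :: real assume x: "1 \<le> x"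
      show "norm (h x t) \<le> C * exp 1 * (t ^ k * exp (- t) * indicator {0..} t)"
      proof (cases "b \<le> x * t")
        case True
        then have t: "t > 0" using b0 x by (smt (verit) mult_nonneg_nonpos)
        have "std_normal_density (exp (x * (t - 1))) \<le> exp (1 - t)"
        proof (cases "t \<le> 1")
          case True
          then have "1 \<le> exp (1 - t)" by simp
          then show ?thesis using std_normal_density_le_1[of "exp (x * (t - 1))"] by linarith
        next
          case False
          then have "(t - 1) * 1 \<le> (t - 1) * x" using x by (intro mult_left_mono) auto
          then have "exp (- (x * (t - 1))) \<le> exp (1 - t)" by (simp add: algebra_simps)
          then show ?thesis
            using order_trans[OF std_normal_density_le_inverse[of "exp (x * (t - 1))"]]
            by (simp add: exp_minus inverse_eq_divide)
        qed
        moreover have "G (- (x * t)) / x ^ k \<le> C * t ^ k"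
          using b[OF True] x by (simp add: field_simps)
        ultimately have "std_normal_density (exp (x * (t - 1))) * (G (- (x * t)) / x ^ k) \<le> exp (1 - t) * (C * t ^ k)"
          using nonneg x by (intro mult_mono) auto
        then show ?thesis using True t nonneg x by (simp add: h_def exp_diff exp_minus field_simps)
      next
        case False
        then show ?thesis using \<open>C > 0\<close> by (auto simp: h_def indicator_def)
      qed
    qed
    \<comment> \<open>At the jump \<open>t = 1\<close> the kernel equals \<open>\<phi> 1\<close> for
      every \<open>x\<close>, which is neither of the two limits.\<close>
    have "AE t in lborel. t \<noteq> 0 \<and> t \<noteq> (1::real)"
      using AE_lborel_singleton[of 0] AE_lborel_singleton[of 1] by eventually_elim simp
    then show "AE t in lborel. ((\<lambda>x. h x t) \<longlongrightarrow> std_normal_density 0 * c * (t ^ k * indicator {0<..<1} t)) at_top"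
    proof eventually_elim
      case (elim t)
      show ?case
      proof (cases "t > 0")
        case False
        have "eventually (\<lambda>x. h x t = 0) at_top"
          using eventually_gt_at_top[of 0]
        proof eventually_elim
          case (elim x)
          then have "x * t \<le> 0" using False by (simp add: mult_le_0_iff)
          then show ?case using b0 by (simp add: h_def)
        qed
        then show ?thesis using False tendsto_eventually by force
      next
        case True
        have xt: "filterlim (\<lambda>x. x * t) at_top at_top"
          using True by real_asymp
        have g: "((\<lambda>x. G (- (x * t)) / (x * t) ^ k * t ^ k) \<longlongrightarrow> c * t ^ k) at_top"
          by (intro tendsto_mult filterlim_compose[OF lim xt] tendsto_const)
        have p: "((\<lambda>x. std_normal_density (exp (x * (t - 1)))) \<longlongrightarrow> std_normal_density 0 * indicator {0<..<1} t) at_top"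
        proof (cases "t < 1")
          case True
          then have "((\<lambda>x. exp (x * (t - 1))) \<longlongrightarrow> 0) at_top" by real_asymp
          from tendsto_std_normal_density[OF this] show ?thesis using True \<open>t > 0\<close> by simp
        next
          case False
          then have t: "t > 1" using elim by simp
          have "((\<lambda>x. std_normal_density (exp (x * (t - 1)))) \<longlongrightarrow> 0) at_top"
            unfolding std_normal_density_def using t by real_asymp
          then show ?thesis using t by simp
        qed
        have "eventually (\<lambda>x. h x t = std_normal_density (exp (x * (t - 1))) * (G (- (x * t)) / (x * t) ^ k * t ^ k)) at_top"
          using eventually_gt_at_top[of 0] xt[unfolded filterlim_at_top, rule_format, of b]
          by eventually_elim (use True in \<open>simp add: h_def power_mult_distrib\<close>)
        moreover have "((\<lambda>x. std_normal_density (exp (x * (t - 1))) * (G (- (x * t)) / (x * t) ^ k * t ^ k))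
            \<longlongrightarrow> std_normal_density 0 * indicator {0<..<1} t * (c * t ^ k)) at_top"
          by (intro tendsto_mult[OF p g])
        ultimately show ?thesis by (simp add: tendsto_cong mult_ac)
      qed
    qed
  qed (auto simp: h_def)
  have "(\<integral>t. t ^ k * indicator {0<..<1} (t::real) \<partial>lborel) = (\<integral>t. t ^ k * indicator {0..1} (t::real) \<partial>lborel)"
  proof (rule integral_cong_AE)
    have "AE t in lborel. t \<noteq> 0 \<and> t \<noteq> (1::real)"
      using AE_lborel_singleton[of 0] AE_lborel_singleton[of 1] by eventually_elim simp
    then show "AE t in lborel. t ^ k * indicator {0<..<1} t = t ^ k * indicator {0..1} (t::real)"
      by eventually_elim (auto simp: indicator_def)
  qed auto
  also have "\<dots> = 1 / real (Suc k)"
    using integral_power[of 0 1 k] by simp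
  finally have val: "(\<integral>t. std_normal_density 0 * c * (t ^ k * indicator {0<..<1} t) \<partial>lborel)
    = std_normal_density 0 * c / real (Suc k)" by simp
  have "((\<lambda>x. 2 * (\<integral>t. h x t \<partial>lborel) + 2 * (I2 x / x ^ Suc k)) \<longlongrightarrow>
      2 * (std_normal_density 0 * c / real (Suc k)) + 2 * 0) at_top"
    by (intro tendsto_intros lim1[unfolded val] lim2)
  moreover have "eventually (\<lambda>x. normal_conv G (- x) / x ^ Suc k =
      2 * (\<integral>t. h x t \<partial>lborel) + 2 * (I2 x / x ^ Suc k)) at_top"
    using eventually_gt_at_top[of 0]
  proof eventually_elim
    case (elim x)
    have "normal_conv G (- x) = 2 * I1 x + 2 * I2 x"
      unfolding I1_def I2_def by (rule normal_conv_split) (use int in auto)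
    then show ?case using I1[OF elim, symmetric] by (simp add: add_divide_distrib)
  qed
  ultimately show ?thesis by (simp add: tendsto_cong mult_ac)
qed

section \<open>Densities of quotients by induction over the numerators\<close>

context prob_space
begin

lemma distributed_lborel_AE_nonzero:
  assumes X: "distributed M lborel X f"
  shows "AE \<omega> in M. X \<omega> \<noteq> (0::real)"
proof -
  have [measurable]: "random_variable borel X" using distributed_measurable[OF X] by simp
  have "AE v in density lborel f. v \<noteq> 0"
    using AE_lborel_singleton[of "0::real"] distributed_borel_measurable[OF X] by (auto simp: AE_density elim: eventually_mono)
  then have "AE v in distr M lborel X. v \<noteq> 0" unfolding distributed_distr_eq_density[OF X] .
  then show ?thesis by (subst (asm) AE_distr_iff) auto
qed

text \<open>In the coordinate \<open>s = ln \<bar>V\<bar>\<close> the law of \<open>V\<close> has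
  density \<open>2 * exp s * G s\<close>. The test function 1 gives the integrability, and in the
  mixture the factor \<open>1 / \<bar>V\<bar>\<close> cancels the Jacobian
  \<open>exp s\<close>.\<close>

lemma
  assumes V: "distributed M lborel V (\<lambda>v. ennreal (G (ln \<bar>v\<bar>)))"
    and nonneg: "\<And>s. G s \<ge> 0" and [measurable]: "G \<in> borel_measurable borel"
  shows integrable_log_density: "integrable lborel (\<lambda>s. exp s * G s)"
    and normal_mixture_eq_normal_conv: "normal_mixture V L = normal_conv G L"
proof -
  have [measurable]: "random_variable borel V"
    using distributed_measurable[OF V] by simp
  have nn: "(\<integral>\<^sup>+\<omega>. ennreal (f \<bar>V \<omega>\<bar>) \<partial>M) = (\<integral>\<^sup>+s. ennreal (2 * (f (exp s) * exp s * G s)) \<partial>lborel)"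
    if f: "\<And>v. f v \<ge> 0" and [measurable]: "f \<in> borel_measurable borel" for f :: "real \<Rightarrow> real"
  proof -
    have "(\<integral>\<^sup>+\<omega>. ennreal (f \<bar>V \<omega>\<bar>) \<partial>M) = (\<integral>\<^sup>+v. ennreal (G (ln \<bar>v\<bar>)) * ennreal (f \<bar>v\<bar>) \<partial>lborel)"
      by (rule distributed_nn_integral[OF V, symmetric]) simp
    also have "\<dots> = (\<integral>\<^sup>+s. ennreal (2 * (f (exp s) * exp s * G s)) \<partial>lborel)"
      using f nonneg
      by (subst nn_integral_lborel_exp)
         (auto intro!: nn_integral_cong simp flip: ennreal_mult' ennreal_plus simp: algebra_simps)
    finally show ?thesis .
  qed
  have "(\<integral>\<^sup>+s. ennreal (2 * (1 * exp s * G s)) \<partial>lborel) = 1"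
    using nn[of "\<lambda>_. 1"] by (simp add: emeasure_space_1)
  then have "integrable lborel (\<lambda>s. 2 * (1 * exp s * G s))"
    using nonneg by (intro integrableI_nonneg) auto
  then show int: "integrable lborel (\<lambda>s. exp s * G s)" by simp
  have sym: "std_normal_density (exp L / v) / \<bar>v\<bar> = std_normal_density (exp L / \<bar>v\<bar>) / \<bar>v\<bar>" for v
    by (simp add: std_normal_density_def power_divide)
  have "ennreal (normal_mixture V L) = (\<integral>\<^sup>+\<omega>. ennreal (std_normal_density (exp L / \<bar>V \<omega>\<bar>) / \<bar>V \<omega>\<bar>) \<partial>M)"
    unfolding normal_mixture_def sym[symmetric]
    by (intro nn_integral_eq_integral[symmetric] normal_mixture_integrable AE_I2) auto
  also have "\<dots> = (\<integral>\<^sup>+\<omega>. ennreal (std_normal_density (exp L / \<bar>V \<omega>\<bar>) / \<bar>\<bar>V \<omega>\<bar>\<bar>) \<partial>M)"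
    by simp
  also have "\<dots> = (\<integral>\<^sup>+s. ennreal (2 * (std_normal_density (exp L / exp s) / \<bar>exp s\<bar> * exp s * G s)) \<partial>lborel)"
    by (rule nn[of "\<lambda>v. std_normal_density (exp L / v) / \<bar>v\<bar>"]) auto
  also have "\<dots> = (\<integral>\<^sup>+s. ennreal (2 * (std_normal_density (exp (L - s)) * G s)) \<partial>lborel)"
    by (simp add: exp_diff)
  also have "\<dots> = ennreal (\<integral>s. 2 * (std_normal_density (exp (L - s)) * G s) \<partial>lborel)"
    using nonneg normal_conv_integrable[OF _ int]
    by (intro nn_integral_eq_integral AE_I2) auto
  also have "\<dots> = ennreal (normal_conv G L)"
    by (simp add: normal_conv_def)
  finally show "normal_mixture V L = normal_conv G L"
    using normal_mixture_nonneg nonneg by (auto simp: ennreal_inj normal_conv_def)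
qed

text \<open>The blocks \<open>{i}\<close> and \<open>I \<union> J\<close> are disjoint, and
  measurable functions of independent blocks are independent.\<close>

lemma indep_var_prod_quotient:
  fixes \<xi> :: "'i \<Rightarrow> 'a \<Rightarrow> real"
  assumes ind: "indep_vars (\<lambda>_. borel) \<xi> K" and fin: "finite I" "finite J"
    and sub: "i \<in> K" "I \<subseteq> K" "J \<subseteq> K" and notin: "i \<notin> I" "i \<notin> J"
  shows "indep_var borel (\<xi> i) borel (\<lambda>\<omega>. (\<Prod>k\<in>I. \<xi> k \<omega>) / (\<Prod>k\<in>J. \<xi> k \<omega>))"
proof -
  have "indep_var borel ((\<lambda>f. f i) \<circ> (\<lambda>\<omega>. restrict (\<lambda>i. \<xi> i \<omega>) {i}))
    borel ((\<lambda>f. (\<Prod>k\<in>I. f k) / (\<Prod>k\<in>J. f k)) \<circ> (\<lambda>\<omega>. restrict (\<lambda>i. \<xi> i \<omega>) (I \<union> J)))"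
    using sub notin fin
    by (intro indep_var_compose[OF indep_var_restrict[OF ind]] borel_measurable_divide borel_measurable_prod)
       auto
  also have "((\<lambda>f. f i) \<circ> (\<lambda>\<omega>. restrict (\<lambda>i. \<xi> i \<omega>) {i})) = \<xi> i" by auto
  also have "((\<lambda>f. (\<Prod>k\<in>I. f k) / (\<Prod>k\<in>J. f k)) \<circ> (\<lambda>\<omega>. restrict (\<lambda>i. \<xi> i \<omega>) (I \<union> J)))
      = (\<lambda>\<omega>. (\<Prod>k\<in>I. \<xi> k \<omega>) / (\<Prod>k\<in>J. \<xi> k \<omega>))"
    by (auto intro!: ext arg_cong2[where f="(/)"] prod.cong)
  finally show ?thesis .
qed

text \<open>One numerator is spent on \<open>G0\<close>, hence \<open>card I - 1\<close>
  convolutions. Nonnegativity and continuity are part of the claim because the next convolution step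
  needs them.\<close>

lemma distributed_prod_quotient:
  fixes \<xi> :: "'i \<Rightarrow> 'a \<Rightarrow> real"
  assumes ind: "indep_vars (\<lambda>_. borel) \<xi> K"
    and std: "\<And>i. i \<in> K \<Longrightarrow> distributed M lborel (\<xi> i) std_normal_density"
    and I: "finite I" "I \<noteq> {}" "I \<subseteq> K" and J: "finite J" "J \<subseteq> K" and disj: "I \<inter> J = {}"
  defines "G0 \<equiv> normal_mixture (\<lambda>\<omega>. 1 / (\<Prod>j\<in>J. \<xi> j \<omega>))"
  defines "G \<equiv> (normal_conv ^^ (card I - 1)) G0"
  shows "distributed M lborel (\<lambda>\<omega>. (\<Prod>i\<in>I. \<xi> i \<omega>) / (\<Prod>j\<in>J. \<xi> j \<omega>)) (\<lambda>y. ennreal (G (ln \<bar>y\<bar>)))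
    \<and> (\<forall>s. G s \<ge> 0) \<and> continuous_on UNIV G"
  using I(1,2,3) disj unfolding G_def
\<comment> \<open>The base has one numerator: a normal factor is what produces the first density,
  whatever the law of the denominator.\<close>
proof (induction rule: finite_ne_induct)
  case (singleton i)
  have nz: "AE \<omega> in M. \<forall>j\<in>J. \<xi> j \<omega> \<noteq> 0"
    using J distributed_lborel_AE_nonzero[OF std] by (intro AE_finite_allI) auto
  have iv: "indep_var borel (\<xi> i) borel (\<lambda>\<omega>. 1 / (\<Prod>j\<in>J. \<xi> j \<omega>))"
    using indep_var_prod_quotient[OF ind, of "{}" J i] singleton J by auto
  have "distributed M lborel (\<lambda>\<omega>. \<xi> i \<omega> * (1 / (\<Prod>j\<in>J. \<xi> j \<omega>))) (\<lambda>y. ennreal (G0 (ln \<bar>y\<bar>)))"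
    unfolding G0_def using nz J singleton
    by (intro distributed_normal_times iv std) (auto elim!: eventually_mono)
  moreover have "continuous_on UNIV G0"
    unfolding G0_def by (rule continuous_normal_mixture[OF indep_var_rv2[OF iv]])
  ultimately show ?case by (auto simp: G0_def normal_mixture_nonneg)
next
  case (insert i I)
  let ?V = "\<lambda>\<omega>. (\<Prod>i\<in>I. \<xi> i \<omega>) / (\<Prod>j\<in>J. \<xi> j \<omega>)"
  let ?G = "(normal_conv ^^ (card I - 1)) G0"
  have V: "distributed M lborel ?V (\<lambda>y. ennreal (?G (ln \<bar>y\<bar>)))"
    and nn: "\<And>s. ?G s \<ge> 0" and cont: "continuous_on UNIV ?G"
    using insert by auto
  have [measurable]: "?G \<in> borel_measurable borel"
    by (rule borel_measurable_continuous_onI[OF cont])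
  have iv: "indep_var borel (\<xi> i) borel ?V"
    using insert J by (intro indep_var_prod_quotient[OF ind]) auto
  \<comment> \<open>The new iterate is again a \<open>normal_mixture\<close>, from which it inherits
    continuity and nonnegativity.\<close>
  have "card (insert i I) - 1 = Suc (card I - 1)"
    using insert by (simp add: card_gt_0_iff)
  then have G: "(normal_conv ^^ (card (insert i I) - 1)) G0 = normal_mixture ?V"
    using normal_mixture_eq_normal_conv[OF V nn \<open>?G \<in> borel_measurable borel\<close>] by (simp add: fun_eq_iff)
  have "distributed M lborel (\<lambda>\<omega>. \<xi> i \<omega> * ?V \<omega>) (\<lambda>y. ennreal (normal_mixture ?V (ln \<bar>y\<bar>)))"
    using insert by (intro distributed_normal_times iv std distributed_lborel_AE_nonzero[OF V]) auto
  moreover have "(\<lambda>\<omega>. (\<Prod>i\<in>insert i I. \<xi> i \<omega>) / (\<Prod>j\<in>J. \<xi> j \<omega>)) = (\<lambda>\<omega>. \<xi> i \<omega> * ?V \<omega>)"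
    using insert by (simp add: mult.assoc)
  ultimately show ?case
    unfolding G using continuous_normal_mixture[OF indep_var_rv2[OF iv]] by (simp add: normal_mixture_nonneg)
qed

end

section \<open>Laplace asymptotics at infinity\<close>

text \<open>A global quadratic lower bound at the minimum \<open>a = 0\<close> of the Laplace phase; it supplies the
  integrable majorant.\<close>

lemma half_exp_sum_ge:
  fixes a n :: real
  assumes n: "n \<ge> 1"
  shows "exp (- 2 * a) / 2 + n / 2 * exp (2 * a / n) - (n + 1) / 2 \<ge> a\<^sup>2 / n"
proof (cases "a \<ge> 0")
  case True
  \<comment> \<open>Only the exponential that grows on this side is expanded to second order, the
    other to first; the linear terms cancel. The quadratic term is \<open>a\<^sup>2 / n\<close> here
    and the larger \<open>a\<^sup>2\<close> for negative \<open>a\<close>.\<close>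
  have "1 + 2 * a / n + (2 * a / n)\<^sup>2 / 2 \<le> exp (2 * a / n)"
    using True n by (intro exp_lower_Taylor_quadratic) auto
  then have "n / 2 * (1 + 2 * a / n + (2 * a / n)\<^sup>2 / 2) \<le> n / 2 * exp (2 * a / n)"
    using n by (intro mult_left_mono) auto
  also have "n / 2 * (1 + 2 * a / n + (2 * a / n)\<^sup>2 / 2) = n / 2 + a + a\<^sup>2 / n"
    using n by (simp add: field_simps power2_eq_square)
  finally show ?thesis using exp_ge_add_one_self[of "- 2 * a"] by (simp add: field_simps)
next
  case False
  have 1: "1 + (- 2 * a) + (- 2 * a)\<^sup>2 / 2 \<le> exp (- 2 * a)"
    using False by (intro exp_lower_Taylor_quadratic) auto
  have "n / 2 * (1 + 2 * a / n) \<le> n / 2 * exp (2 * a / n)"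
    using n by (intro mult_left_mono exp_ge_add_one_self) auto
  moreover have "n / 2 * (1 + 2 * a / n) = n / 2 + a" using n by (simp add: field_simps)
  moreover have "a\<^sup>2 / n \<le> a\<^sup>2" using n by (simp add: divide_le_eq mult_le_cancel_left1)
  moreover have "1 / 2 - a + a\<^sup>2 \<le> exp (- 2 * a) / 2" using 1 by (simp add: power2_eq_square)
  ultimately show ?thesis by (simp add: add_divide_distrib)
qed

lemma has_bochner_integral_gaussian:
  fixes a :: real
  assumes "a > 0"
  shows "has_bochner_integral lborel (\<lambda>x. exp (- a * x\<^sup>2)) (sqrt (pi / a))"
proof -
  define \<sigma> where "\<sigma> = sqrt (1 / (2 * a))"
  have s: "\<sigma> > 0" "\<sigma>\<^sup>2 = 1 / (2 * a)" using assms by (auto simp: \<sigma>_def)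
  have "has_bochner_integral lborel (\<lambda>x. sqrt (pi / a) * normal_density 0 \<sigma> x) (sqrt (pi / a) * 1)"
    using s by (intro has_bochner_integral_mult_right) (simp add: has_bochner_integral_iff)
  also have "(\<lambda>x. sqrt (pi / a) * normal_density 0 \<sigma> x) = (\<lambda>x. exp (- a * x\<^sup>2))"
    using assms by (intro ext) (simp add: normal_density_def s)
  finally show ?thesis by simp
qed

text \<open>In terms of \<open>y = exp s\<close> this is
  \<open>y powr (- (n - 1) / n) * exp (- n / 2 * y powr (2 / n))\<close>, up to a constant the tail
  of the density of a product of \<open>n\<close> standard normals. For \<open>n = 1\<close> it is
  \<open>\<phi> y / \<phi> 0\<close> exactly.\<close>

definition laplace_profile :: "real \<Rightarrow> real \<Rightarrow> real"
  where "laplace_profile n s = exp (- (s * (n - 1) / n)) * exp (- (n / 2 * exp (2 * s / n)))"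

text \<open>With \<open>L = (n + 1) ln \<mu>\<close> and \<open>s = n ln \<mu> + x / \<mu>\<close> the integrand is centred at the maximum of the
  phase and rescaled to unit width.\<close>

lemma normal_conv_laplace:
  fixes n :: real
  assumes [measurable]: "G \<in> borel_measurable borel" and nonneg: "\<And>s. G s \<ge> 0"
    and int: "integrable lborel (\<lambda>s. exp s * G s)" and n: "n \<ge> 1"
    and lim: "((\<lambda>s. G s / laplace_profile n s) \<longlongrightarrow> c) at_top"
  shows "((\<lambda>L. normal_conv G L / laplace_profile (n + 1) L) \<longlongrightarrow> c * sqrt (2 * n / (n + 1))) at_top"
proof -
  define T where "T = laplace_profile n"
  have T0: "T s > 0" for s by (simp add: T_def laplace_profile_def)
  define C where "C = \<bar>c\<bar> + 1"
  have "C > 0" by (simp add: C_def)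
  have "eventually (\<lambda>s. G s \<le> C * T s) at_top"
    unfolding C_def by (rule eventually_bound_of_ratio_tendsto) (use lim T0 in \<open>auto simp: T_def\<close>)
  then obtain b where b: "\<And>s. s \<ge> b \<Longrightarrow> G s \<le> C * T s"
    by (auto simp: eventually_at_top_linorder)
  let ?A = "{b..}"
  \<comment> \<open>The phase \<open>exp (2 * (L - s)) / 2 + n / 2 * exp (2 * s / n)\<close> is
    stationary where \<open>L - s = s / n\<close>, that is at \<open>s = n * ln \<mu>\<close>. Its
    minimum is \<open>(n + 1) / 2 * \<mu>\<^sup>2\<close>, the exponent in \<open>Q\<close>, and its
    curvature is of order \<open>\<mu>\<^sup>2\<close>, whence the width
    \<open>1 / \<mu>\<close>.\<close>
  define L where "L \<mu> = (n + 1) * ln \<mu>" for \<mu> :: real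
  define Q where "Q \<mu> = \<mu> powr (- n) * exp (- ((n + 1) / 2 * \<mu>\<^sup>2))" for \<mu> :: real
  have Q: "laplace_profile (n + 1) (L \<mu>) = Q \<mu>" if "\<mu> > 0" for \<mu>
  proof -
    have "exp (2 * L \<mu> / (n + 1)) = exp (ln \<mu> + ln \<mu>)" using n by (simp add: L_def)
    also have "\<dots> = \<mu>\<^sup>2" using that by (simp only: exp_add exp_ln power2_eq_square)
    finally show ?thesis using that n
      by (simp add: laplace_profile_def Q_def powr_def L_def)
  qed
  have Q0: "Q \<mu> > 0" if "\<mu> > 0" for \<mu> using that by (simp add: Q_def)
  define D where "D = (\<integral>s. exp s * G s \<partial>lborel)"
  have D0: "D \<ge> 0" unfolding D_def using nonneg by simp
  define I1 where "I1 \<mu> = (\<integral>s. std_normal_density (exp (L \<mu> - s)) * (G s * indicator ?A s) \<partial>lborel)" for \<mu>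
  define I2 where "I2 \<mu> = (\<integral>s. std_normal_density (exp (L \<mu> - s)) * (G s * indicator (- ?A) s) \<partial>lborel)" for \<mu>
  \<comment> \<open>Below \<open>b\<close> the bound \<open>1 / u\<close> on the kernel would be too
    weak against the exponentially small \<open>Q\<close>. The spare factor
    \<open>exp (- u\<^sup>2 / 4)\<close> at \<open>u = exp (L - s)\<close> is used instead, and
    \<open>s < b\<close> gives \<open>u\<^sup>2 / 4 \<ge> exp (2 * L) * d\<close>.\<close>
  define d where "d = exp (- 2 * b) / 4"
  have d0: "d > 0" by (simp add: d_def)
  have I2: "0 \<le> I2 \<mu>" "I2 \<mu> \<le> D * (exp (- L \<mu>) * exp (- exp (2 * L \<mu>) * d))" for \<mu>
  proof -
    show "0 \<le> I2 \<mu>" unfolding I2_def using nonneg by (intro integral_nonneg_AE AE_I2) auto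
    define K where "K = exp (- L \<mu>) * exp (- exp (2 * L \<mu>) * d)"
    have "I2 \<mu> \<le> (\<integral>s. K * (exp s * G s) \<partial>lborel)"
      unfolding I2_def
    proof (rule integral_mono')
      show "integrable lborel (\<lambda>s. K * (exp s * G s))" using int by simp
      fix s show "std_normal_density (exp (L \<mu> - s)) * (G s * indicator (- ?A) s) \<le> K * (exp s * G s)"
      proof (cases "s \<in> ?A")
        case False
        then have s: "s < b" by simp
        let ?u = "exp (L \<mu> - s)"
        have "?u * std_normal_density ?u \<le> exp (- ?u\<^sup>2 / 4)"
          using abs_times_std_normal_density_le[of ?u] by simp
        also have "- ?u\<^sup>2 / 4 \<le> - exp (2 * L \<mu>) * d"
        proof -
          have "exp (2 * L \<mu> - 2 * b) \<le> exp (2 * (L \<mu> - s))" using s by simp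
          also have "\<dots> = ?u\<^sup>2" by (rule exp_double)
          finally show ?thesis by (simp add: d_def exp_diff exp_minus field_simps)
        qed
        finally have "?u * std_normal_density ?u \<le> exp (- exp (2 * L \<mu>) * d)" by simp
        then have "std_normal_density ?u \<le> K * exp s"
          by (simp add: K_def exp_diff exp_minus field_simps)
        then have "std_normal_density ?u * G s \<le> K * exp s * G s"
          by (intro mult_right_mono nonneg)
        then show ?thesis using False by simp
      qed (use nonneg in \<open>simp add: K_def\<close>)
      show "0 \<le> K * (exp s * G s)" using nonneg by (simp add: K_def)
    qed
    then have "I2 \<mu> \<le> D * K" by (simp add: D_def mult_ac)
    then show "I2 \<mu> \<le> D * (exp (- L \<mu>) * exp (- exp (2 * L \<mu>) * d))" by (simp add: K_def)
  qed
  have lim2: "((\<lambda>\<mu>. I2 \<mu> / Q \<mu>) \<longlongrightarrow> 0) at_top"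
  proof (rule tendsto_sandwich)
    show "((\<lambda>x. 0) \<longlongrightarrow> (0::real)) at_top" by simp
    show "((\<lambda>\<mu>. D * (1 / \<mu> * exp ((n + 1) / 2 * \<mu>\<^sup>2 - d * \<mu> ^ 4))) \<longlongrightarrow> 0) at_top"
      using d0 n by real_asymp
    show "eventually (\<lambda>\<mu>. 0 \<le> I2 \<mu> / Q \<mu>) at_top"
      using eventually_gt_at_top[of 0] by eventually_elim (use I2 Q0 in \<open>simp add: less_imp_le\<close>)
    show "eventually (\<lambda>\<mu>. I2 \<mu> / Q \<mu> \<le> D * (1 / \<mu> * exp ((n + 1) / 2 * \<mu>\<^sup>2 - d * \<mu> ^ 4))) at_top"
      using eventually_ge_at_top[of 1]
    proof eventually_elim
      case (elim \<mu>)
      \<comment> \<open>Since \<open>n \<ge> 1\<close>, the decay exponent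
        \<open>exp (2 * L \<mu>) = \<mu> powr (2 * (n + 1))\<close> is at least
        \<open>\<mu> ^ 4\<close>, enough to beat the \<open>\<mu>\<^sup>2\<close> in the exponent of
        \<open>1 / Q \<mu>\<close>.\<close>
      have "\<mu> ^ 4 = \<mu> powr 4" using elim by (simp add: powr_numeral)
      also have "\<dots> \<le> \<mu> powr (2 * (n + 1))" using elim n by (intro powr_mono) auto
      also have "\<dots> = exp (2 * L \<mu>)" using elim by (simp add: powr_def L_def mult_ac)
      finally have "exp (- exp (2 * L \<mu>) * d) \<le> exp (- d * \<mu> ^ 4)" using d0 by (simp add: mult_ac)
      moreover have "exp (- L \<mu>) = \<mu> powr (- n) * (1 / \<mu>)"
      proof -
        have "- L \<mu> = - n * ln \<mu> + - ln \<mu>" by (simp add: L_def algebra_simps)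
        then have "exp (- L \<mu>) = exp (- n * ln \<mu>) * exp (- ln \<mu>)" by (simp only: exp_add)
        then show ?thesis using elim by (simp add: powr_def exp_minus inverse_eq_divide)
      qed
      ultimately have "exp (- L \<mu>) * exp (- exp (2 * L \<mu>) * d) \<le> \<mu> powr (- n) * (1 / \<mu>) * exp (- d * \<mu> ^ 4)"
        by (metis exp_ge_zero mult_left_mono)
      then have "I2 \<mu> \<le> D * (\<mu> powr (- n) * (1 / \<mu>) * exp (- d * \<mu> ^ 4))"
        using D0 by (intro order_trans[OF I2(2)] mult_left_mono)
      then have "I2 \<mu> / Q \<mu> \<le> D * (\<mu> powr (- n) * (1 / \<mu>) * exp (- d * \<mu> ^ 4)) / Q \<mu>"
        using Q0[of \<mu>] elim by (intro divide_right_mono) auto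
      also have "\<dots> = D * (1 / \<mu> * exp ((n + 1) / 2 * \<mu>\<^sup>2 - d * \<mu> ^ 4))"
      proof -
        have "(n + 1) / 2 * \<mu>\<^sup>2 - d * \<mu> ^ 4 = - d * \<mu> ^ 4 - - ((n + 1) / 2 * \<mu>\<^sup>2)" by simp
        then have "exp ((n + 1) / 2 * \<mu>\<^sup>2 - d * \<mu> ^ 4) = exp (- d * \<mu> ^ 4) / exp (- ((n + 1) / 2 * \<mu>\<^sup>2))"
          by (simp only: exp_diff)
        then show ?thesis using elim by (simp add: Q_def)
      qed
      finally show ?case .
    qed
  qed
  \<comment> \<open>All dependence on \<open>G\<close> is collected in a factor that is bounded by
    \<open>C\<close> everywhere and tends to \<open>c\<close>.\<close>
  define R where "R s = G s * indicator ?A s / T s" for s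
  have R: "0 \<le> R s" "R s \<le> C" for s
    using b[of s] nonneg[of s] T0[of s] \<open>C > 0\<close> by (auto simp: R_def indicator_def field_simps)
  have Rlim: "(R \<longlongrightarrow> c) at_top"
  proof (rule Lim_transform_eventually[OF lim])
    show "eventually (\<lambda>s. G s / laplace_profile n s = R s) at_top"
      using eventually_ge_at_top[of b] by eventually_elim (simp add: R_def T_def)
  qed
  \<comment> \<open>The excess of the phase over its minimum at
    \<open>s = n * ln \<mu> + x / \<mu>\<close>. It tends to \<open>(1 + 1 / n) * x\<^sup>2\<close>,
    and the global lower bound at \<open>a = x / \<mu>\<close> keeps it above
    \<open>x\<^sup>2 / n\<close>.\<close>
  define E where "E \<mu> x = \<mu>\<^sup>2 * (exp (- 2 * (x / \<mu>)) / 2 + n / 2 * exp (2 * (x / \<mu>) / n) - (n + 1) / 2)" for \<mu> x :: real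
  define h where "h \<mu> x = 1 / sqrt (2 * pi) * (R (n * ln \<mu> + x / \<mu>) * (exp (- ((n - 1) / n * (x / \<mu>))) * exp (- E \<mu> x)))" for \<mu> x :: real
  have [measurable]: "T \<in> borel_measurable borel" unfolding T_def laplace_profile_def by measurable
  have [measurable]: "R \<in> borel_measurable borel" unfolding R_def by measurable
  have [measurable]: "h \<mu> \<in> borel_measurable borel" for \<mu> unfolding h_def E_def by measurable
  have I1: "I1 \<mu> / Q \<mu> = (\<integral>x. h \<mu> x \<partial>lborel)" if "\<mu> > 0" for \<mu>
  proof -
    have "I1 \<mu> = 1 / \<mu> * (\<integral>x. std_normal_density (exp (L \<mu> - (n * ln \<mu> + 1 / \<mu> * x))) *
        (G (n * ln \<mu> + 1 / \<mu> * x) * indicator ?A (n * ln \<mu> + 1 / \<mu> * x)) \<partial>lborel)"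
      unfolding I1_def using that
      by (subst lborel_integral_real_affine[where c="1 / \<mu>" and t="n * ln \<mu>"]) simp_all
    also have "\<dots> = 1 / \<mu> * (\<integral>x. \<mu> * Q \<mu> * h \<mu> x \<partial>lborel)"
    proof (rule arg_cong2[where f="(*)", OF refl], rule Bochner_Integration.integral_cong[OF refl])
      fix x
      let ?s = "n * ln \<mu> + x / \<mu>"
      have "exp (L \<mu> - ?s) = \<mu> * exp (- (x / \<mu>))"
      proof -
        have "L \<mu> - ?s = ln \<mu> + - (x / \<mu>)" by (simp add: L_def algebra_simps)
        then show ?thesis using that by (simp only: exp_add exp_ln)
      qed
      then have p: "std_normal_density (exp (L \<mu> - ?s)) = 1 / sqrt (2 * pi) * exp (- (\<mu>\<^sup>2 * (exp (- 2 * (x / \<mu>)) / 2)))"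
        by (simp add: std_normal_density_def power_mult_distrib exp_double[symmetric])
      have "exp (2 * ?s / n) = exp (ln \<mu> + ln \<mu> + 2 * (x / \<mu>) / n)"
        using n by (simp add: field_simps)
      also have "\<dots> = \<mu>\<^sup>2 * exp (2 * (x / \<mu>) / n)"
        using that by (simp only: exp_add exp_ln power2_eq_square)
      finally have "exp (2 * ?s / n) = \<mu>\<^sup>2 * exp (2 * (x / \<mu>) / n)" .
      moreover have "exp (- (?s * (n - 1) / n)) = \<mu> * \<mu> powr (- n) * exp (- ((n - 1) / n * (x / \<mu>)))"
      proof -
        have "- (?s * (n - 1) / n) = ln \<mu> + (- n) * ln \<mu> + - ((n - 1) / n * (x / \<mu>))"
          using n that by (simp add: field_simps)
        moreover have "exp ((- n) * ln \<mu>) = \<mu> powr (- n)" using that by (simp add: powr_def)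
        ultimately show ?thesis using that by (simp only: exp_add exp_ln)
      qed
      ultimately have T: "T ?s = \<mu> * \<mu> powr (- n) * exp (- ((n - 1) / n * (x / \<mu>))) * exp (- (n / 2 * (\<mu>\<^sup>2 * exp (2 * (x / \<mu>) / n))))"
        by (simp add: T_def laplace_profile_def)
      have E: "exp (- (\<mu>\<^sup>2 * (exp (- 2 * (x / \<mu>)) / 2))) * exp (- (n / 2 * (\<mu>\<^sup>2 * exp (2 * (x / \<mu>) / n))))
          = exp (- ((n + 1) / 2 * \<mu>\<^sup>2)) * exp (- E \<mu> x)"
        unfolding exp_add[symmetric] E_def by (rule arg_cong[where f=exp]) (simp add: field_simps)
      have "G ?s * indicator ?A ?s = R ?s * T ?s"
        using T0[of ?s] by (simp add: R_def)
      then have "std_normal_density (exp (L \<mu> - ?s)) * (G ?s * indicator ?A ?s)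
        = 1 / sqrt (2 * pi) * R ?s * \<mu> * \<mu> powr (- n) * exp (- ((n - 1) / n * (x / \<mu>))) *
          (exp (- (\<mu>\<^sup>2 * (exp (- 2 * (x / \<mu>)) / 2))) * exp (- (n / 2 * (\<mu>\<^sup>2 * exp (2 * (x / \<mu>) / n)))))"
        unfolding p T by (simp only: mult_ac)
      also have "\<dots> = \<mu> * Q \<mu> * h \<mu> x"
        unfolding E Q_def h_def by (simp only: mult_ac)
      finally show "std_normal_density (exp (L \<mu> - (n * ln \<mu> + 1 / \<mu> * x))) *
        (G (n * ln \<mu> + 1 / \<mu> * x) * indicator ?A (n * ln \<mu> + 1 / \<mu> * x)) = \<mu> * Q \<mu> * h \<mu> x" by simp
    qed
    finally show ?thesis using that Q0[OF that] by simp
  qed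
  have lim1: "((\<lambda>\<mu>. \<integral>x. h \<mu> x \<partial>lborel) \<longlongrightarrow>
      (\<integral>x. 1 / sqrt (2 * pi) * c * exp (- (1 + 1 / n) * x\<^sup>2) \<partial>lborel)) at_top"
  proof (rule integral_dominated_convergence_at_top)
    \<comment> \<open>Half of \<open>x\<^sup>2 / n\<close> is spent on the slowly varying factor,
      which is at most \<open>exp \<bar>x\<bar>\<close> for \<open>\<mu> \<ge> 1\<close>, through
      \<open>\<bar>x\<bar> \<le> n / 2 + x\<^sup>2 / (2 * n)\<close>; the other half remains as the
      Gaussian majorant.\<close>
    show "integrable lborel (\<lambda>x. C * exp (n / 2) * exp (- (1 / (2 * n)) * x\<^sup>2))"
      using has_bochner_integral_gaussian[of "1 / (2 * n)"] n
      by (intro integrable_mult_right) (auto simp: has_bochner_integral_iff)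
    show "\<forall>\<^sub>F \<mu> in at_top. AE x in lborel. norm (h \<mu> x) \<le> C * exp (n / 2) * exp (- (1 / (2 * n)) * x\<^sup>2)"
      using eventually_ge_at_top[of 1]
    proof (eventually_elim, intro AE_I2)
      fix \<mu> x :: real assume \<mu>: "1 \<le> \<mu>"
      have "x\<^sup>2 / n = \<mu>\<^sup>2 * ((x / \<mu>)\<^sup>2 / n)" using \<mu> by (simp add: power_divide)
      also have "\<dots> \<le> E \<mu> x"
        unfolding E_def by (intro mult_left_mono half_exp_sum_ge n) auto
      finally have 1: "x\<^sup>2 / n \<le> E \<mu> x" .
      have "- ((n - 1) / n * (x / \<mu>)) \<le> (n - 1) / n * (\<bar>x\<bar> / \<mu>)"
      proof -
        have "(n - 1) / n * (- (x / \<mu>)) \<le> (n - 1) / n * (\<bar>x\<bar> / \<mu>)"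
          using n \<mu> by (intro mult_left_mono) (auto simp: field_simps)
        then show ?thesis by simp
      qed
      also have "\<dots> \<le> 1 * (\<bar>x\<bar> / 1)" using n \<mu> by (intro mult_mono divide_left_mono) auto
      also have "1 * (\<bar>x\<bar> / 1) \<le> n / 2 + x\<^sup>2 / (2 * n)"
      proof -
        have "0 \<le> (\<bar>x\<bar> - n)\<^sup>2" by simp
        then have "2 * n * \<bar>x\<bar> \<le> n * n + x\<^sup>2" by (simp add: power2_eq_square algebra_simps)
        then show ?thesis using n by (simp add: field_simps power2_eq_square)
      qed
      finally have "- ((n - 1) / n * (x / \<mu>)) + - E \<mu> x \<le> n / 2 + - (1 / (2 * n)) * x\<^sup>2"
        using 1 n by (simp add: field_simps)
      then have 2: "exp (- ((n - 1) / n * (x / \<mu>))) * exp (- E \<mu> x) \<le> exp (n / 2) * exp (- (1 / (2 * n)) * x\<^sup>2)"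
        unfolding exp_add[symmetric] by simp
      have "norm (h \<mu> x) = h \<mu> x" using R by (simp add: h_def)
      also have "\<dots> \<le> 1 * (C * (exp (n / 2) * exp (- (1 / (2 * n)) * x\<^sup>2)))"
        unfolding h_def by (intro mult_mono inverse_sqrt_2pi_le_1 2 R mult_nonneg_nonneg) (use \<open>C > 0\<close> in auto)
      finally show "norm (h \<mu> x) \<le> C * exp (n / 2) * exp (- (1 / (2 * n)) * x\<^sup>2)" by (simp add: mult_ac)
    qed
    show "AE x in lborel. ((\<lambda>\<mu>. h \<mu> x) \<longlongrightarrow> 1 / sqrt (2 * pi) * c * exp (- (1 + 1 / n) * x\<^sup>2)) at_top"
    proof (rule AE_I2)
      fix x :: real
      have E: "((\<lambda>\<mu>. E \<mu> x) \<longlongrightarrow> (1 + 1 / n) * x\<^sup>2) at_top"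
        unfolding E_def using n by (real_asymp simp: field_simps power2_eq_square)
      have s: "filterlim (\<lambda>\<mu>. n * ln \<mu> + x / \<mu>) at_top at_top"
        using n by real_asymp
      have e: "((\<lambda>\<mu>. exp (- ((n - 1) / n * (x / \<mu>)))) \<longlongrightarrow> 1) at_top"
        using n by real_asymp
      have "((\<lambda>\<mu>. h \<mu> x) \<longlongrightarrow> 1 / sqrt (2 * pi) * (c * (1 * exp (- ((1 + 1 / n) * x\<^sup>2))))) at_top"
        unfolding h_def by (intro tendsto_intros filterlim_compose[OF Rlim s] e E)
      then show "((\<lambda>\<mu>. h \<mu> x) \<longlongrightarrow> 1 / sqrt (2 * pi) * c * exp (- (1 + 1 / n) * x\<^sup>2)) at_top"
        by (simp only: mult_1_left mult_minus_left mult.assoc)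
    qed
  qed measurable
  have "(\<integral>x. 1 / sqrt (2 * pi) * c * exp (- (1 + 1 / n) * x\<^sup>2) \<partial>lborel) = 1 / sqrt (2 * pi) * c * sqrt (pi / (1 + 1 / n))"
    unfolding integral_mult_right_zero
    using n by (subst has_bochner_integral_integral_eq[OF has_bochner_integral_gaussian]) (simp_all add: add_pos_pos)
  \<comment> \<open>The half isolated here cancels the factor 2 in
    \<open>normal_conv\<close>.\<close>
  also have "\<dots> = c * sqrt (2 * n / (n + 1)) / 2"
  proof -
    have "1 / sqrt (2 * pi) * sqrt (pi / (1 + 1 / n)) = sqrt (1 / (2 * pi) * (pi / (1 + 1 / n)))"
      by (simp only: real_sqrt_mult real_sqrt_divide real_sqrt_one)
    also have "1 / (2 * pi) * (pi / (1 + 1 / n)) = 2 * n / (n + 1) / 4"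
      using n by (simp add: field_simps)
    also have "sqrt (2 * n / (n + 1) / 4) = sqrt (2 * n / (n + 1)) / 2"
      by (simp only: real_sqrt_divide[of _ 4] real_sqrt_four)
    finally have "1 / sqrt (2 * pi) * sqrt (pi / (1 + 1 / n)) = sqrt (2 * n / (n + 1)) / 2" .
    from arg_cong[OF this, of "\<lambda>x. c * x"] show ?thesis by simp
  qed
  finally have val: "(\<integral>x. 1 / sqrt (2 * pi) * c * exp (- (1 + 1 / n) * x\<^sup>2) \<partial>lborel) = c * sqrt (2 * n / (n + 1)) / 2" .
  have "((\<lambda>\<mu>. 2 * (\<integral>x. h \<mu> x \<partial>lborel) + 2 * (I2 \<mu> / Q \<mu>)) \<longlongrightarrow>
      2 * (c * sqrt (2 * n / (n + 1)) / 2) + 2 * 0) at_top"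
    by (intro tendsto_add tendsto_mult tendsto_const lim1[unfolded val] lim2)
  moreover have "eventually (\<lambda>\<mu>. 2 * (\<integral>x. h \<mu> x \<partial>lborel) + 2 * (I2 \<mu> / Q \<mu>) =
      normal_conv G (L \<mu>) / laplace_profile (n + 1) (L \<mu>)) at_top"
    using eventually_gt_at_top[of 0]
  proof eventually_elim
    case (elim \<mu>)
    have "normal_conv G (L \<mu>) = 2 * I1 \<mu> + 2 * I2 \<mu>"
      unfolding I1_def I2_def by (rule normal_conv_split) (use int in auto)
    then show ?case using I1[OF elim, symmetric] Q[OF elim] by (simp add: add_divide_distrib)
  qed
  ultimately have *: "((\<lambda>\<mu>. normal_conv G (L \<mu>) / laplace_profile (n + 1) (L \<mu>)) \<longlongrightarrow> c * sqrt (2 * n / (n + 1))) at_top"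
    using Lim_transform_eventually by fastforce
  have "filterlim (\<lambda>l. exp (l / (n + 1))) at_top at_top" using n by real_asymp
  from filterlim_compose[OF * this] show ?thesis using n by (simp add: L_def)
qed

section \<open>Products and quotients of standard normal variables\<close>

text \<open>A point of disagreement would have an open neighbourhood of disagreement, which contains
  an interval of positive length.\<close>

lemma AE_lborel_eq_imp_eq:
  fixes f g :: "real \<Rightarrow> real"
  assumes ae: "AE x in lborel. f x = g x" and S: "open S" and cont: "continuous_on S f" "continuous_on S g"
    and x: "x \<in> S"
  shows "f x = g x"
proof (rule ccontr)
  assume neq: "f x \<noteq> g x"
  let ?U = "S \<inter> (\<lambda>x. f x - g x) -` (- {0})"
  have "open ?U" using cont S by (intro continuous_open_preimage continuous_on_diff) auto
  moreover have "x \<in> ?U" using neq x by simp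
  ultimately obtain e where e: "e > 0" "ball x e \<subseteq> ?U" by (meson openE)
  have "{x<..<x + e} \<subseteq> ?U" using e by (auto simp: subset_iff dist_real_def)
  then have "{x<..<x + e} \<subseteq> {y \<in> space lborel. f y \<noteq> g y}" by auto
  moreover obtain N where "{y \<in> space lborel. f y \<noteq> g y} \<subseteq> N" "emeasure lborel N = 0" "N \<in> sets lborel"
    using AE_E[OF ae] by auto
  ultimately have "emeasure lborel {x<..<x + e} \<le> 0"
    using emeasure_mono[of "{x<..<x + e}" N lborel] by auto
  then show False using e by simp
qed

text \<open>The factorial collects the divisors \<open>Suc k\<close> of the single steps. The
  hypotheses stop at \<open>m\<close> because the iterates are known to be densities only as far as
  there are numerators to realise them.\<close>

lemma normal_conv_iterate_log_power:
  assumes nonneg: "\<And>j s. j < m \<Longrightarrow> (normal_conv ^^ j) G s \<ge> 0"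
    and meas: "\<And>j. j < m \<Longrightarrow> (normal_conv ^^ j) G \<in> borel_measurable borel"
    and int: "\<And>j. j < m \<Longrightarrow> integrable lborel (\<lambda>s. exp s * (normal_conv ^^ j) G s)"
    and lim: "((\<lambda>x. G (- x)) \<longlongrightarrow> c) at_top" and k: "k \<le> m"
  shows "((\<lambda>x. (normal_conv ^^ k) G (- x) / x ^ k) \<longlongrightarrow> (2 * std_normal_density 0) ^ k * c / fact k) at_top"
  using k
proof (induction k)
  case 0
  then show ?case using lim by simp
next
  case (Suc k)
  from normal_conv_log_power[OF meas nonneg int Suc.IH] Suc.prems show ?case
    by (simp add: mult_ac)
qed

text \<open>The step factors \<open>2 i / (i + 1)\<close> under the root, for \<open>i\<close> from
  1 to \<open>k\<close>, telescope to \<open>2 ^ k / (k + 1)\<close>; the start is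
  \<open>\<phi> 0\<close> times the profile with \<open>n = 1\<close>.\<close>

lemma normal_conv_iterate_laplace:
  assumes nonneg: "\<And>j s. j < m \<Longrightarrow> (normal_conv ^^ j) G s \<ge> 0"
    and meas: "\<And>j. j < m \<Longrightarrow> (normal_conv ^^ j) G \<in> borel_measurable borel"
    and int: "\<And>j. j < m \<Longrightarrow> integrable lborel (\<lambda>s. exp s * (normal_conv ^^ j) G s)"
    and G: "\<And>L. G L = std_normal_density (exp L)" and k: "k \<le> m"
  shows "((\<lambda>L. (normal_conv ^^ k) G L / laplace_profile (real (Suc k)) L)
    \<longlongrightarrow> sqrt (2 ^ k / real (Suc k)) / sqrt (2 * pi)) at_top"
  using k
proof (induction k)
  case 0
  have "G L / laplace_profile 1 L = 1 / sqrt (2 * pi)" for L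
    by (simp add: G std_normal_density_def laplace_profile_def exp_double)
  then show ?case by simp
next
  case (Suc k)
  have "((\<lambda>L. normal_conv ((normal_conv ^^ k) G) L / laplace_profile (real (Suc k) + 1) L)
    \<longlongrightarrow> sqrt (2 ^ k / real (Suc k)) / sqrt (2 * pi) * sqrt (2 * real (Suc k) / (real (Suc k) + 1))) at_top"
    using Suc by (intro normal_conv_laplace meas nonneg int) auto
  moreover have "sqrt (2 ^ k / real (Suc k)) / sqrt (2 * pi) * sqrt (2 * real (Suc k) / (real (Suc k) + 1))
    = sqrt (2 ^ Suc k / real (Suc (Suc k))) / sqrt (2 * pi)"
  proof -
    have gen: "x / a * (2 * a / (a + 1)) = 2 * x / (a + 1)" if "a > 0" for a x :: real
      using that by (simp add: field_simps)
    have "2 ^ k / real (Suc k) * (2 * real (Suc k) / (real (Suc k) + 1)) = 2 ^ Suc k / real (Suc (Suc k))"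
      using gen[of "real (Suc k)" "2 ^ k"] by (simp add: add.commute)
    then have "sqrt (2 ^ k / real (Suc k)) * sqrt (2 * real (Suc k) / (real (Suc k) + 1)) = sqrt (2 ^ Suc k / real (Suc (Suc k)))"
      by (simp only: real_sqrt_mult[symmetric])
    then show ?thesis by (simp only: times_divide_eq_left)
  qed
  ultimately show ?case by (simp add: add.commute)
qed

section \<open>Standardised quotients: constants and pointwise identification of the density\<close>

context prob_space
begin

lemma expectation_abs_prod_std_normal:
  fixes \<xi> :: "'i \<Rightarrow> 'a \<Rightarrow> real"
  assumes ind: "indep_vars (\<lambda>_. borel) \<xi> J" and fin: "finite J"
    and std: "\<And>j. j \<in> J \<Longrightarrow> distributed M lborel (\<xi> j) std_normal_density"
  shows "has_bochner_integral M (\<lambda>\<omega>. \<bar>\<Prod>j\<in>J. \<xi> j \<omega>\<bar>) (sqrt (2 / pi) ^ card J)"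
proof (rule has_bochner_integral_nn_integral)
  have rv [measurable]: "j \<in> J \<Longrightarrow> \<xi> j \<in> borel_measurable M" for j
    using ind by (auto simp: indep_vars_def)
  then show "(\<lambda>\<omega>. \<bar>\<Prod>j\<in>J. \<xi> j \<omega>\<bar>) \<in> borel_measurable M" by measurable
  have 1: "(\<integral>\<^sup>+\<omega>. ennreal \<bar>\<xi> j \<omega>\<bar> \<partial>M) = ennreal (sqrt (2 / pi))" if "j \<in> J" for j
  proof -
    have "(\<integral>\<^sup>+\<omega>. ennreal \<bar>\<xi> j \<omega>\<bar> \<partial>M) = (\<integral>\<^sup>+x. ennreal (std_normal_density x) * ennreal \<bar>x\<bar> \<partial>lborel)"
      by (rule distributed_nn_integral[OF std[OF that], symmetric]) simp
    also have "\<dots> = (\<integral>\<^sup>+x. ennreal (std_normal_density x * \<bar>x\<bar>) \<partial>lborel)"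
      by (simp add: ennreal_mult)
    also have "\<dots> = ennreal (sqrt (2 / pi))"
      using std_normal_moment_abs_odd[of 0] by (subst nn_integral_eq_integral) (auto simp: has_bochner_integral_iff)
    finally show ?thesis .
  qed
  have "(\<integral>\<^sup>+\<omega>. ennreal \<bar>\<Prod>j\<in>J. \<xi> j \<omega>\<bar> \<partial>M) = (\<integral>\<^sup>+\<omega>. (\<Prod>j\<in>J. ennreal \<bar>\<xi> j \<omega>\<bar>) \<partial>M)"
    by (simp add: abs_prod prod_ennreal)
  also have "\<dots> = (\<Prod>j\<in>J. \<integral>\<^sup>+\<omega>. ennreal \<bar>\<xi> j \<omega>\<bar> \<partial>M)"
    by (intro indep_vars_nn_integral fin indep_vars_compose2[OF ind]) auto
  also have "\<dots> = ennreal (sqrt (2 / pi) ^ card J)"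
    by (simp add: 1 ennreal_power)
  finally show "(\<integral>\<^sup>+\<omega>. ennreal \<bar>\<Prod>j\<in>J. \<xi> j \<omega>\<bar> \<partial>M) = ennreal (sqrt (2 / pi) ^ card J)" .
qed auto

text \<open>With \<open>V = 1 / D\<close> the integrand becomes
  \<open>\<phi> (exp (- x) * D) * \<bar>D\<bar>\<close>, which is dominated by
  \<open>\<bar>D\<bar>\<close>; so the first absolute moment of the denominator is the majorant as
  well as the limit. The conventions for division by 0 agree with this rewriting at
  \<open>D = 0\<close>.\<close>

lemma normal_mixture_inverse_at_bot:
  assumes D: "integrable M (\<lambda>\<omega>. \<bar>D \<omega>\<bar>)" and [measurable]: "random_variable borel D"
  shows "((\<lambda>x. normal_mixture (\<lambda>\<omega>. 1 / D \<omega>) (- x)) \<longlongrightarrow> std_normal_density 0 * expectation (\<lambda>\<omega>. \<bar>D \<omega>\<bar>)) at_top"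
proof -
  have "((\<lambda>x. expectation (\<lambda>\<omega>. std_normal_density (exp (- x) * D \<omega>) * \<bar>D \<omega>\<bar>))
      \<longlongrightarrow> expectation (\<lambda>\<omega>. std_normal_density 0 * \<bar>D \<omega>\<bar>)) at_top"
  proof (rule integral_dominated_convergence_at_top[where w="\<lambda>\<omega>. \<bar>D \<omega>\<bar>"])
    show "AE \<omega> in M. ((\<lambda>x. std_normal_density (exp (- x) * D \<omega>) * \<bar>D \<omega>\<bar>) \<longlongrightarrow> std_normal_density 0 * \<bar>D \<omega>\<bar>) at_top"
    proof (rule AE_I2)
      fix \<omega>
      have "((\<lambda>x. exp (- x) * D \<omega>) \<longlongrightarrow> 0) at_top" by real_asymp
      then show "((\<lambda>x. std_normal_density (exp (- x) * D \<omega>) * \<bar>D \<omega>\<bar>) \<longlongrightarrow> std_normal_density 0 * \<bar>D \<omega>\<bar>) at_top"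
        by (intro tendsto_intros)
    qed
    show "\<forall>\<^sub>F x in at_top. AE \<omega> in M. norm (std_normal_density (exp (- x) * D \<omega>) * \<bar>D \<omega>\<bar>) \<le> \<bar>D \<omega>\<bar>"
      by (intro always_eventually allI AE_I2) (simp add: abs_mult mult_left_le_one_le std_normal_density_le_1)
  qed (use D in auto)
  then show ?thesis using D by (simp add: normal_mixture_def)
qed

text \<open>The intermediate iterates have the properties of densities because they are densities:
  any \<open>k + 1\<close> of the numerators realise the \<open>k\<close>-th iterate.\<close>

lemma prod_quotient_iterates:
  fixes \<xi> :: "'i \<Rightarrow> 'a \<Rightarrow> real"
  assumes ind: "indep_vars (\<lambda>_. borel) \<xi> K"
    and std: "\<And>i. i \<in> K \<Longrightarrow> distributed M lborel (\<xi> i) std_normal_density"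
    and I: "finite I" "I \<subseteq> K" and J: "finite J" "J \<subseteq> K" and disj: "I \<inter> J = {}" and k: "k < card I"
  defines "G \<equiv> (normal_conv ^^ k) (normal_mixture (\<lambda>\<omega>. 1 / (\<Prod>j\<in>J. \<xi> j \<omega>)))"
  shows "G s \<ge> 0" "G \<in> borel_measurable borel" "integrable lborel (\<lambda>s. exp s * G s)"
proof -
  obtain A where A: "A \<subseteq> I" "card A = Suc k" "finite A"
    using k by (meson Suc_leI obtain_subset_with_card_n)
  then have ne: "A \<noteq> {}" by auto
  have *: "distributed M lborel (\<lambda>\<omega>. (\<Prod>i\<in>A. \<xi> i \<omega>) / (\<Prod>j\<in>J. \<xi> j \<omega>)) (\<lambda>y. ennreal (G (ln \<bar>y\<bar>)))
    \<and> (\<forall>s. G s \<ge> 0) \<and> continuous_on UNIV G"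
    using distributed_prod_quotient[OF ind std A(3) ne _ J] A I disj
    unfolding G_def A(2) by auto
  show "G s \<ge> 0" using * by simp
  show m: "G \<in> borel_measurable borel" using * by (intro borel_measurable_continuous_onI) simp
  show "integrable lborel (\<lambda>s. exp s * G s)" using * m by (intro integrable_log_density) auto
qed

lemma density_prod_quotient_log:
  fixes \<xi> :: "'i \<Rightarrow> 'a \<Rightarrow> real"
  assumes ind: "indep_vars (\<lambda>_. borel) \<xi> (I \<union> J)"
    and std: "\<And>i. i \<in> I \<union> J \<Longrightarrow> distributed M lborel (\<xi> i) std_normal_density"
    and I: "finite I" "I \<noteq> {}" and J: "finite J" and disj: "I \<inter> J = {}"
    and f: "distributed M lborel (\<lambda>\<omega>. (\<Prod>i\<in>I. \<xi> i \<omega>) / (\<Prod>j\<in>J. \<xi> j \<omega>)) (\<lambda>z. ennreal (f z))"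
    and nonneg: "\<And>z. f z \<ge> 0" and cont: "continuous_on (UNIV - {0}) f"
  obtains G where "\<And>z. z \<noteq> 0 \<Longrightarrow> f z = G (ln \<bar>z\<bar>)"
    "((\<lambda>x. G (- x) / x ^ (card I - 1)) \<longlongrightarrow> sqrt (2 / pi) ^ (card I + card J) / 2 / fact (card I - 1)) at_top"
proof -
  define D where "D \<omega> = (\<Prod>j\<in>J. \<xi> j \<omega>)" for \<omega>
  define G0 where "G0 = normal_mixture (\<lambda>\<omega>. 1 / D \<omega>)"
  define G where "G = (normal_conv ^^ (card I - 1)) G0"
  have *: "distributed M lborel (\<lambda>\<omega>. (\<Prod>i\<in>I. \<xi> i \<omega>) / (\<Prod>j\<in>J. \<xi> j \<omega>)) (\<lambda>y. ennreal (G (ln \<bar>y\<bar>)))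
    \<and> (\<forall>s. G s \<ge> 0) \<and> continuous_on UNIV G"
    unfolding G_def G0_def D_def using I J disj by (intro distributed_prod_quotient[OF ind std]) auto
  have "f z = G (ln \<bar>z\<bar>)" if "z \<noteq> 0" for z
  proof (rule AE_lborel_eq_imp_eq[of f "\<lambda>z. G (ln \<bar>z\<bar>)" "UNIV - {0}"])
    show "AE z in lborel. f z = G (ln \<bar>z\<bar>)"
      using distributed_unique[OF f *[THEN conjunct1]] * nonneg by (auto elim!: eventually_mono)
    show "continuous_on (UNIV - {0}) (\<lambda>z. G (ln \<bar>z\<bar>))"
      by (rule continuous_on_compose2[OF *[THEN conjunct2, THEN conjunct2]]) (auto intro!: continuous_intros)
  qed (use cont that in auto)
  moreover have "((\<lambda>x. G (- x) / x ^ (card I - 1)) \<longlongrightarrow> sqrt (2 / pi) ^ (card I + card J) / 2 / fact (card I - 1)) at_top"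
  proof -
    have h: "has_bochner_integral M (\<lambda>\<omega>. \<bar>D \<omega>\<bar>) (sqrt (2 / pi) ^ card J)"
      unfolding D_def using std J
      by (intro expectation_abs_prod_std_normal indep_vars_subset[OF ind]) auto
    have rv: "j \<in> J \<Longrightarrow> random_variable borel (\<xi> j)" for j
      using ind by (auto simp: indep_vars_def)
    have Dm: "random_variable borel D" unfolding D_def by (intro borel_measurable_prod rv)
    have lim0: "((\<lambda>x. G0 (- x)) \<longlongrightarrow> std_normal_density 0 * sqrt (2 / pi) ^ card J) at_top"
      using normal_mixture_inverse_at_bot[of D] h Dm by (simp add: G0_def has_bochner_integral_iff)
    have lim: "((\<lambda>x. G (- x) / x ^ (card I - 1)) \<longlongrightarrow> (2 * std_normal_density 0) ^ (card I - 1) *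
        (std_normal_density 0 * sqrt (2 / pi) ^ card J) / fact (card I - 1)) at_top"
      unfolding G_def
    proof (rule normal_conv_iterate_log_power[OF _ _ _ lim0, of "card I"])
      fix j assume "j < card I"
      with prod_quotient_iterates[OF ind std, of I J j] I J disj
      show "(normal_conv ^^ j) G0 s \<ge> 0" "(normal_conv ^^ j) G0 \<in> borel_measurable borel"
        "integrable lborel (\<lambda>s. exp s * (normal_conv ^^ j) G0 s)" for s
        by (auto simp: G0_def D_def)
    qed simp
    \<comment> \<open>Each convolution contributes the same constant as each absolute moment. The
      first numerator gives only \<open>\<phi> 0\<close>, which leaves the overall division by
      2.\<close>
    have p: "2 * std_normal_density 0 = sqrt (2 / pi)"
      by (simp add: std_normal_density_0 real_sqrt_divide real_sqrt_mult field_simps)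
    have "card I = Suc (card I - 1)" using I by (simp add: card_gt_0_iff)
    then have "sqrt (2 / pi) ^ (card I + card J) = sqrt (2 / pi) * sqrt (2 / pi) ^ (card I - 1) * sqrt (2 / pi) ^ card J"
      by (metis power_Suc power_add)
    then have "(2 * std_normal_density 0) ^ (card I - 1) * (std_normal_density 0 * sqrt (2 / pi) ^ card J)
        = sqrt (2 / pi) ^ (card I + card J) / 2"
      unfolding p[symmetric] by simp
    then show ?thesis using lim by (simp only:)
  qed
  ultimately show thesis by (rule that)
qed

text \<open>Inversion is the reflection \<open>s \<mapsto> - s\<close> in logarithmic coordinates;
  rewriting the Jacobian \<open>exp (- s)\<close> as \<open>exp s / (exp s)\<^sup>2\<close> yields
  the factor \<open>1 / z\<^sup>2\<close>.\<close>

lemma distributed_reciprocal: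
  assumes Y: "distributed M lborel Y (\<lambda>y. ennreal (G (ln \<bar>y\<bar>)))"
    and nonneg: "\<And>s. G s \<ge> 0" and [measurable]: "G \<in> borel_measurable borel"
  shows "distributed M lborel (\<lambda>\<omega>. 1 / Y \<omega>) (\<lambda>z. ennreal (G (- ln \<bar>z\<bar>) / z\<^sup>2))"
proof -
  have [measurable]: "random_variable borel Y" using distributed_measurable[OF Y] by simp
  show ?thesis
    unfolding distributed_def
  proof safe
    show "distr M lborel (\<lambda>\<omega>. 1 / Y \<omega>) = density lborel (\<lambda>z. ennreal (G (- ln \<bar>z\<bar>) / z\<^sup>2))"
    proof (rule measure_eqI)
      fix A assume "A \<in> sets (distr M lborel (\<lambda>\<omega>. 1 / Y \<omega>))"
      then have [measurable]: "A \<in> sets borel" by simp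
      have "emeasure (distr M lborel (\<lambda>\<omega>. 1 / Y \<omega>)) A = (\<integral>\<^sup>+\<omega>. indicator A (1 / Y \<omega>) \<partial>M)"
        by (subst nn_integral_indicator[symmetric], simp, subst nn_integral_distr) auto
      also have "\<dots> = (\<integral>\<^sup>+y. ennreal (G (ln \<bar>y\<bar>)) * indicator A (1 / y) \<partial>lborel)"
        by (rule distributed_nn_integral[OF Y, symmetric]) simp
      also have "\<dots> = (\<integral>\<^sup>+s. (ennreal (G s) * indicator A (exp (- s)) + ennreal (G s) * indicator A (- exp (- s))) * ennreal (exp s) \<partial>lborel)"
        by (subst nn_integral_lborel_exp) (auto simp: exp_minus inverse_eq_divide)
      also have "\<dots> = (\<integral>\<^sup>+s. (ennreal (G (- s)) * indicator A (exp s) + ennreal (G (- s)) * indicator A (- exp s)) * ennreal (exp (- s)) \<partial>lborel)"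
        by (subst nn_integral_real_affine[where c="-1" and t=0]) auto
      also have "\<dots> = (\<integral>\<^sup>+s. (ennreal (G (- s) / (exp s)\<^sup>2) * indicator A (exp s) + ennreal (G (- s) / (exp s)\<^sup>2) * indicator A (- exp s)) * ennreal (exp s) \<partial>lborel)"
      proof (rule nn_integral_cong)
        fix s
        have "ennreal (G (- s) / (exp s)\<^sup>2) * ennreal (exp s) = ennreal (G (- s)) * ennreal (exp (- s))"
          using nonneg by (simp add: ennreal_mult'[symmetric] exp_minus power2_eq_square field_simps)
        then show "(ennreal (G (- s)) * indicator A (exp s) + ennreal (G (- s)) * indicator A (- exp s)) * ennreal (exp (- s))
            = (ennreal (G (- s) / (exp s)\<^sup>2) * indicator A (exp s) + ennreal (G (- s) / (exp s)\<^sup>2) * indicator A (- exp s)) * ennreal (exp s)"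
          by (simp add: indicator_def distrib_right)
      qed
      also have "\<dots> = (\<integral>\<^sup>+z. ennreal (G (- ln \<bar>z\<bar>) / z\<^sup>2) * indicator A z \<partial>lborel)"
        by (subst nn_integral_lborel_exp) auto
      finally show "emeasure (distr M lborel (\<lambda>\<omega>. 1 / Y \<omega>)) A = emeasure (density lborel (\<lambda>z. ennreal (G (- ln \<bar>z\<bar>) / z\<^sup>2))) A"
        by (simp add: emeasure_density)
    qed simp
  qed simp_all
qed

text \<open>The denominator is itself treated as a quotient with \<open>I\<close> as numerators and
  empty denominator. Its first mixing variable is the constant 1, so the iteration starts from
  \<open>\<phi> (exp L)\<close>.\<close>

lemma density_reciprocal_prod_laplace:
  fixes \<xi> :: "'i \<Rightarrow> 'a \<Rightarrow> real"
  assumes ind: "indep_vars (\<lambda>_. borel) \<xi> I"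
    and std: "\<And>i. i \<in> I \<Longrightarrow> distributed M lborel (\<xi> i) std_normal_density"
    and I: "finite I" "I \<noteq> {}"
    and f: "distributed M lborel (\<lambda>\<omega>. 1 / (\<Prod>i\<in>I. \<xi> i \<omega>)) (\<lambda>z. ennreal (f z))"
    and nonneg: "\<And>z. f z \<ge> 0" and cont: "continuous_on (UNIV - {0}) f"
  obtains G where "\<And>z. z \<noteq> 0 \<Longrightarrow> f z = G (- ln \<bar>z\<bar>) / z\<^sup>2"
    "((\<lambda>L. G L / laplace_profile (real (card I)) L)
      \<longlongrightarrow> sqrt (2 ^ (card I - 1) / real (card I)) / sqrt (2 * pi)) at_top"
proof -
  define G0 where "G0 = normal_mixture (\<lambda>\<omega>. 1)"
  have G0: "G0 L = std_normal_density (exp L)" for L by (simp add: G0_def normal_mixture_def prob_space)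
  define G where "G = (normal_conv ^^ (card I - 1)) G0"
  have *: "distributed M lborel (\<lambda>\<omega>. \<Prod>i\<in>I. \<xi> i \<omega>) (\<lambda>y. ennreal (G (ln \<bar>y\<bar>)))
    \<and> (\<forall>s. G s \<ge> 0) \<and> continuous_on UNIV G"
    using distributed_prod_quotient[OF ind std, of I "{}"] I by (simp add: G_def G0_def)
  then have m: "G \<in> borel_measurable borel" by (intro borel_measurable_continuous_onI) simp
  have "f z = G (- ln \<bar>z\<bar>) / z\<^sup>2" if "z \<noteq> 0" for z
  proof (rule AE_lborel_eq_imp_eq[of f "\<lambda>z. G (- ln \<bar>z\<bar>) / z\<^sup>2" "UNIV - {0}"])
    have "distributed M lborel (\<lambda>\<omega>. 1 / (\<Prod>i\<in>I. \<xi> i \<omega>)) (\<lambda>z. ennreal (G (- ln \<bar>z\<bar>) / z\<^sup>2))"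
      using * m by (intro distributed_reciprocal) auto
    from distributed_unique[OF f this] show "AE z in lborel. f z = G (- ln \<bar>z\<bar>) / z\<^sup>2"
      using * nonneg by (auto elim!: eventually_mono)
    show "continuous_on (UNIV - {0}) (\<lambda>z. G (- ln \<bar>z\<bar>) / z\<^sup>2)"
      by (rule continuous_on_divide, rule continuous_on_compose2[OF *[THEN conjunct2, THEN conjunct2]])
         (auto intro!: continuous_intros)
  qed (use cont that in auto)
  moreover have "((\<lambda>L. G L / laplace_profile (real (card I)) L)
      \<longlongrightarrow> sqrt (2 ^ (card I - 1) / real (card I)) / sqrt (2 * pi)) at_top"
  proof -
    have "((\<lambda>L. G L / laplace_profile (real (Suc (card I - 1))) L)
      \<longlongrightarrow> sqrt (2 ^ (card I - 1) / real (Suc (card I - 1))) / sqrt (2 * pi)) at_top"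
      unfolding G_def
    proof (rule normal_conv_iterate_laplace[OF _ _ _ G0, of "card I"])
      fix j assume "j < card I"
      with prod_quotient_iterates[OF ind std, of I "{}" j] I
      show "(normal_conv ^^ j) G0 s \<ge> 0" "(normal_conv ^^ j) G0 \<in> borel_measurable borel"
        "integrable lborel (\<lambda>s. exp s * (normal_conv ^^ j) G0 s)" for s
        by (auto simp: G0_def)
    qed simp
    moreover have "Suc (card I - 1) = card I" using I by (simp add: card_gt_0_iff)
    ultimately show ?thesis by simp
  qed
  ultimately show thesis by (rule that)
qed

end

section \<open>Return from standardised variables to the limit at the origin\<close>

text \<open>The scale inside the logarithm is lost, because
  \<open>ln \<bar>c * z\<bar> / ln \<bar>z\<bar>\<close> tends to 1; only the outer factor
  \<open>c\<close> survives.\<close>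

lemma asymp_equiv_of_log_power:
  fixes G :: "real \<Rightarrow> real"
  assumes lim: "((\<lambda>x. G (- x) / x ^ k) \<longlongrightarrow> A) at_top" and A: "A \<noteq> 0" and c: "c > 0"
  shows "(\<lambda>z. c * G (ln \<bar>c * z\<bar>)) \<sim>[at 0] (\<lambda>z. c * A * (- ln \<bar>z\<bar>) ^ k)"
proof (rule asymp_equivI')
  have x: "filterlim (\<lambda>z. - ln \<bar>c * z\<bar>) at_top (at 0)"
    using c by real_asymp
  have r: "((\<lambda>z. - ln \<bar>c * z\<bar> / - ln \<bar>z\<bar>) \<longlongrightarrow> 1) (at 0)"
    using c by real_asymp
  have "((\<lambda>z. G (- (- ln \<bar>c * z\<bar>)) / (- ln \<bar>c * z\<bar>) ^ k / A * (- ln \<bar>c * z\<bar> / - ln \<bar>z\<bar>) ^ k) \<longlongrightarrow> A / A * 1 ^ k) (at 0)"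
    by (intro tendsto_mult tendsto_divide tendsto_power tendsto_const r filterlim_compose[OF lim x] A)
  moreover have "eventually (\<lambda>z. G (- (- ln \<bar>c * z\<bar>)) / (- ln \<bar>c * z\<bar>) ^ k / A * (- ln \<bar>c * z\<bar> / - ln \<bar>z\<bar>) ^ k
      = c * G (ln \<bar>c * z\<bar>) / (c * A * (- ln \<bar>z\<bar>) ^ k)) (at 0)"
    using x[unfolded filterlim_at_top_dense, rule_format, of 0]
  proof eventually_elim
    case (elim z)
    have *: "g / a ^ k / A * (a / b) ^ k = c * g / (c * A * b ^ k)" if "a > 0" for g a b :: real
      using that c by (simp add: power_divide)
    show ?case using *[OF elim] by (simp only: minus_minus)
  qed
  ultimately show "((\<lambda>z. c * G (ln \<bar>c * z\<bar>) / (c * A * (- ln \<bar>z\<bar>) ^ k)) \<longlongrightarrow> 1) (at 0)"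
    using A Lim_transform_eventually by fastforce
qed

text \<open>Here the scale enters an exponential and must be kept exactly, so the profile is
  evaluated in closed form. Its power and \<open>1 / z\<^sup>2\<close> combine by
  \<open>(n - 1) / n - 2 = - (n + 1) / n\<close>, and the powers of \<open>c\<close> outside the
  exponential collapse to \<open>c powr (- 1 / n)\<close>.\<close>

lemma asymp_equiv_of_laplace:
  fixes G :: "real \<Rightarrow> real"
  assumes lim: "((\<lambda>L. G L / laplace_profile n L) \<longlongrightarrow> B) at_top" and B: "B \<noteq> 0" and c: "c > 0" and n: "n > 0"
  shows "(\<lambda>z. c * (G (- ln \<bar>c * z\<bar>) / (c * z)\<^sup>2)) \<sim>[at 0]
    (\<lambda>z. B / c powr (1 / n) * \<bar>z\<bar> powr (- ((n + 1) / n)) * exp (- (n / (2 * (c * \<bar>z\<bar>) powr (2 / n)))))"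
    (is "_ \<sim>[_] ?R")
proof (rule asymp_equivI')
  have R: "?R z = B * (c * (laplace_profile n (- ln \<bar>c * z\<bar>) / (c * z)\<^sup>2))" if z: "z \<noteq> 0" for z
  proof -
    define w where "w = c * \<bar>z\<bar>"
    have w: "w > 0" "\<bar>c * z\<bar> = w" using c z by (auto simp: w_def abs_mult)
    have w2: "(c * z)\<^sup>2 = w powr 2" using w by (simp add: w_def power_mult_distrib powr_numeral)
    have 1: "exp (2 * - ln w / n) = 1 / w powr (2 / n)"
      using w by (simp add: powr_def exp_minus inverse_eq_divide)
    have 2: "exp (- (- ln w * (n - 1) / n)) = w powr ((n - 1) / n)"
      using w by (simp add: powr_def mult.commute)
    have "c * (w powr ((n - 1) / n) / w powr 2) = c * w powr ((n - 1) / n - 2)"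
      by (simp add: powr_diff)
    also have "(n - 1) / n - 2 = - ((n + 1) / n)"
      using n by (simp add: field_simps)
    also have "c * w powr (- ((n + 1) / n)) = c powr 1 * c powr (- ((n + 1) / n)) * \<bar>z\<bar> powr (- ((n + 1) / n))"
      using c z by (simp add: w_def powr_mult)
    also have "c powr 1 * c powr (- ((n + 1) / n)) = c powr (1 + - ((n + 1) / n))"
      by (simp only: powr_add)
    also have "1 + - ((n + 1) / n) = - (1 / n)"
      using n by (simp add: field_simps)
    finally have 3: "c * (w powr ((n - 1) / n) / w powr 2) = 1 / c powr (1 / n) * \<bar>z\<bar> powr (- ((n + 1) / n))"
      by (simp add: powr_minus inverse_eq_divide)
    have "B * (c * (laplace_profile n (- ln \<bar>c * z\<bar>) / (c * z)\<^sup>2)) =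
      B * (c * (w powr ((n - 1) / n) / w powr 2)) * exp (- (n / 2 * (1 / w powr (2 / n))))"
      unfolding w w2 laplace_profile_def 1 2 by simp
    also have "\<dots> = ?R z"
      unfolding 3 unfolding w_def by simp
    finally show ?thesis by simp
  qed
  have x: "filterlim (\<lambda>z. - ln \<bar>c * z\<bar>) at_top (at 0)"
    using c by real_asymp
  have "((\<lambda>z. G (- ln \<bar>c * z\<bar>) / laplace_profile n (- ln \<bar>c * z\<bar>) / B) \<longlongrightarrow> B / B) (at 0)"
    by (intro tendsto_divide tendsto_const filterlim_compose[OF lim x] B)
  moreover have "eventually (\<lambda>z. G (- ln \<bar>c * z\<bar>) / laplace_profile n (- ln \<bar>c * z\<bar>) / B
      = c * (G (- ln \<bar>c * z\<bar>) / (c * z)\<^sup>2) / ?R z) (at 0)"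
    using eventually_neq_at_within[of 0]
  proof eventually_elim
    case (elim z)
    show ?case unfolding R[OF elim] using c elim by simp
  qed
  ultimately show "((\<lambda>z. c * (G (- ln \<bar>c * z\<bar>) / (c * z)\<^sup>2) / ?R z) \<longlongrightarrow> 1) (at 0)"
    using B Lim_transform_eventually by fastforce
qed

theorem theorem2p6:
  fixes P :: "'a measure"
    and M N :: nat
    and X Y :: "nat \<Rightarrow> 'a \<Rightarrow> real"
    and \<sigma>X \<sigma>Y :: "nat \<Rightarrow> real"
    and f\<^sub>Z :: "real \<Rightarrow> real"
  defines "\<sigma> \<equiv> (\<Prod>i=1..M. \<sigma>X i)"
    and "s \<equiv> (\<Prod>j=1..N. \<sigma>Y j)"
  assumes "prob_space P"
    and "\<And>i. i \<in> {1..M} \<Longrightarrow> \<sigma>X i > 0"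
    and "\<And>j. j \<in> {1..N} \<Longrightarrow> \<sigma>Y j > 0"
    and "\<And>i. i \<in> {1..M} \<Longrightarrow> distributed P lborel (X i) (normal_density 0 (\<sigma>X i))"
    and "\<And>j. j \<in> {1..N} \<Longrightarrow> distributed P lborel (Y j) (normal_density 0 (\<sigma>Y j))"
    and "prob_space.indep_vars P (\<lambda>_. borel) (case_sum X Y) ({1..M} <+> {1..N})"
    and "distributed P lborel (\<lambda>\<omega>. (\<Prod>i=1..M. X i \<omega>) / (\<Prod>j=1..N. Y j \<omega>)) f\<^sub>Z"
    and "\<And>z. f\<^sub>Z z \<ge> 0"
    and "continuous_on (UNIV - {0}) f\<^sub>Z"
  shows "(M \<ge> 1 \<longrightarrow>
            f\<^sub>Z \<sim>[at 0]
              (\<lambda>z. 2 powr ((real M + real N - 2) / 2) * s / (pi powr ((real M + real N) / 2) * \<sigma>)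
                     * ((- ln \<bar>z\<bar>) ^ (M - 1) / fact (M - 1))))
       \<and> (M = 0 \<and> N \<ge> 1 \<longrightarrow>
            f\<^sub>Z \<sim>[at 0]
              (\<lambda>z. 2 powr ((real N - 2) / 2) / (sqrt (real N * pi) * s powr (1 / real N))
                     * \<bar>z\<bar> powr (- ((real N + 1) / real N))
                     * exp (- (real N / (2 * (s * \<bar>z\<bar>) powr (2 / real N))))))"
proof -
  interpret prob_space P by fact
  define K where "K = {1..M} <+> {1..N}"
  define \<tau> where "\<tau> = case_sum \<sigma>X \<sigma>Y"
  define \<xi> where "\<xi> = (\<lambda>i \<omega>. case_sum X Y i \<omega> / \<tau> i)"
  define I where "I = (Inl ` {1..M} :: (nat + nat) set)"
  define J where "J = (Inr ` {1..N} :: (nat + nat) set)"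
  have K: "K = I \<union> J" by (auto simp: K_def I_def J_def)
  have IJ: "finite I" "finite J" "I \<inter> J = {}" "card I = M" "card J = N"
    by (auto simp: I_def J_def card_image)
  have pos: "\<sigma> > 0" "s > 0" unfolding \<sigma>_def s_def using assms(4,5) by (auto intro!: prod_pos)
  \<comment> \<open>Standardising every factor multiplies the quotient by \<open>c\<close>, so
    \<open>f\<close> below is the density of \<open>c * Z\<close> and
    \<open>f\<^sub>Z z = c * f (c * z)\<close>.\<close>
  define c where "c = s / \<sigma>"
  have c: "c > 0" using pos by (simp add: c_def)
  have ind: "indep_vars (\<lambda>_. borel) \<xi> K"
    unfolding \<xi>_def K_def by (rule indep_vars_compose2[OF assms(8), of "\<lambda>i x. x / \<tau> i"]) simp
  have std: "distributed P lborel (\<xi> i) std_normal_density" if "i \<in> K" for i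
  proof -
    have "\<tau> i > 0" "distributed P lborel (case_sum X Y i) (normal_density 0 (\<tau> i))"
      using that assms(4-7) by (auto simp: K_def \<tau>_def)
    then show ?thesis
      using normal_standard_normal_convert[of "\<tau> i" "case_sum X Y i" 0] by (simp add: \<xi>_def)
  qed
  have prod: "(\<Prod>i\<in>I. \<xi> i \<omega>) = (\<Prod>i=1..M. X i \<omega>) / \<sigma>" "(\<Prod>j\<in>J. \<xi> j \<omega>) = (\<Prod>j=1..N. Y j \<omega>) / s" for \<omega>
    by (simp_all add: I_def J_def prod.reindex \<xi>_def \<tau>_def \<sigma>_def s_def prod_dividef)
  define f where "f z = f\<^sub>Z (z / c) / c" for z
  have f0: "f z \<ge> 0" for z using assms(10) c by (simp add: f_def)
  have fcont: "continuous_on (UNIV - {0}) f"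
    unfolding f_def
    by (rule continuous_on_divide, rule continuous_on_compose2[OF assms(11)])
       (use c in \<open>auto intro!: continuous_intros\<close>)
  have fZ: "f\<^sub>Z z = c * f (c * z)" for z using c by (simp add: f_def)
  have "distributed P lborel (\<lambda>\<omega>. 0 + c * ((\<Prod>i=1..M. X i \<omega>) / (\<Prod>j=1..N. Y j \<omega>))) (\<lambda>z. ennreal (f\<^sub>Z ((z - 0) / c)) / ennreal \<bar>c\<bar>)"
    using c by (intro distributed_affine[OF assms(9)]) auto
  also have "(\<lambda>\<omega>. 0 + c * ((\<Prod>i=1..M. X i \<omega>) / (\<Prod>j=1..N. Y j \<omega>))) = (\<lambda>\<omega>. (\<Prod>i\<in>I. \<xi> i \<omega>) / (\<Prod>j\<in>J. \<xi> j \<omega>))"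
    using pos by (simp add: prod c_def field_simps)
  also have "(\<lambda>z. ennreal (f\<^sub>Z ((z - 0) / c)) / ennreal \<bar>c\<bar>) = (\<lambda>z. ennreal (f z))"
    using c assms(10) by (simp add: f_def divide_ennreal)
  finally have f: "distributed P lborel (\<lambda>\<omega>. (\<Prod>i\<in>I. \<xi> i \<omega>) / (\<Prod>j\<in>J. \<xi> j \<omega>)) (\<lambda>z. ennreal (f z))" .
  show ?thesis
  proof (intro conjI impI)
    assume M: "M \<ge> 1"
    then have "I \<noteq> {}" by (auto simp: I_def)
    obtain G where G: "\<And>z. z \<noteq> 0 \<Longrightarrow> f z = G (ln \<bar>z\<bar>)"
      and lim: "((\<lambda>x. G (- x) / x ^ (M - 1)) \<longlongrightarrow> sqrt (2 / pi) ^ (M + N) / 2 / fact (M - 1)) at_top"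
      using density_prod_quotient_log[OF ind[unfolded K] std[unfolded K] IJ(1) \<open>I \<noteq> {}\<close> IJ(2,3) f f0 fcont]
      unfolding IJ(4,5) by blast
    let ?A = "sqrt (2 / pi) ^ (M + N) / 2 / fact (M - 1)"
    have "sqrt (2 / pi) ^ (M + N) = 2 powr (real (M + N) / 2) / pi powr (real (M + N) / 2)"
      by (simp add: powr_half_sqrt[symmetric] powr_realpow[symmetric] powr_powr powr_divide)
    \<comment> \<open>The factor 2 split off cancels the division by 2 in \<open>?A\<close>.\<close>
    moreover have "2 powr (real (M + N) / 2) = 2 * 2 powr ((real M + real N - 2) / 2)"
      by (simp add: diff_divide_distrib powr_diff)
    ultimately have A: "c * ?A * x = 2 powr ((real M + real N - 2) / 2) * s / (pi powr ((real M + real N) / 2) * \<sigma>)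
        * (x / fact (M - 1))" for x
      by (simp add: c_def mult_ac)
    have "f\<^sub>Z \<sim>[at 0] (\<lambda>z. c * G (ln \<bar>c * z\<bar>))"
      by (rule asymp_equiv_refl_ev, use eventually_neq_at_within[of 0] in eventually_elim) (use c G in \<open>simp add: fZ\<close>)
    also have "(\<lambda>z. c * G (ln \<bar>c * z\<bar>)) \<sim>[at 0] (\<lambda>z. c * ?A * (- ln \<bar>z\<bar>) ^ (M - 1))"
      by (rule asymp_equiv_of_log_power[OF lim _ c]) simp
    finally show "f\<^sub>Z \<sim>[at 0]
              (\<lambda>z. 2 powr ((real M + real N - 2) / 2) * s / (pi powr ((real M + real N) / 2) * \<sigma>)
                     * ((- ln \<bar>z\<bar>) ^ (M - 1) / fact (M - 1)))"
      unfolding A .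
  next
    assume MN: "M = 0 \<and> N \<ge> 1"
    then have "J \<noteq> {}" "I = {}" by (auto simp: I_def J_def)
    \<comment> \<open>For \<open>M = 0\<close> the empty product gives
      \<open>\<sigma> = 1\<close>.\<close>
    have cs: "c = s" using MN by (simp add: c_def \<sigma>_def)
    have f': "distributed P lborel (\<lambda>\<omega>. 1 / (\<Prod>j\<in>J. \<xi> j \<omega>)) (\<lambda>z. ennreal (f z))"
      using f \<open>I = {}\<close> by simp
    have KJ: "K = J" using K \<open>I = {}\<close> by simp
    obtain G where G: "\<And>z. z \<noteq> 0 \<Longrightarrow> f z = G (- ln \<bar>z\<bar>) / z\<^sup>2"
      and lim: "((\<lambda>L. G L / laplace_profile (real N) L) \<longlongrightarrow> sqrt (2 ^ (N - 1) / real N) / sqrt (2 * pi)) at_top"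
      using density_reciprocal_prod_laplace[OF ind[unfolded KJ] std[unfolded KJ] IJ(2) \<open>J \<noteq> {}\<close> f' f0 fcont]
      unfolding IJ(5) by blast
    let ?B = "sqrt (2 ^ (N - 1) / real N) / sqrt (2 * pi)"
    have "sqrt (2 ^ (N - 1)) = 2 powr ((real N - 1) / 2)"
      using MN by (simp add: powr_half_sqrt[symmetric] powr_realpow[symmetric] powr_powr)
    \<comment> \<open>The missing half power of 2 is the \<open>sqrt 2\<close> contained in
      \<open>sqrt (2 * pi)\<close>.\<close>
    moreover have "2 powr ((real N - 2) / 2) = 2 powr ((real N - 1) / 2 - 1 / 2)"
      by (rule arg_cong[where f="(powr) 2"]) (simp add: field_simps)
    then have "2 powr ((real N - 2) / 2) = 2 powr ((real N - 1) / 2) / sqrt 2"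
      by (simp add: powr_diff powr_half_sqrt)
    ultimately have B: "?B = 2 powr ((real N - 2) / 2) / sqrt (real N * pi)"
      by (simp add: real_sqrt_divide real_sqrt_mult)
    have "f\<^sub>Z \<sim>[at 0] (\<lambda>z. c * (G (- ln \<bar>c * z\<bar>) / (c * z)\<^sup>2))"
      by (rule asymp_equiv_refl_ev, use eventually_neq_at_within[of 0] in eventually_elim) (use c G in \<open>simp add: fZ\<close>)
    also have "(\<lambda>z. c * (G (- ln \<bar>c * z\<bar>) / (c * z)\<^sup>2)) \<sim>[at 0]
        (\<lambda>z. ?B / c powr (1 / real N) * \<bar>z\<bar> powr (- ((real N + 1) / real N)) * exp (- (real N / (2 * (c * \<bar>z\<bar>) powr (2 / real N)))))"
      by (rule asymp_equiv_of_laplace[OF lim _ c]) (use MN in simp_all)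
    finally show "f\<^sub>Z \<sim>[at 0]
              (\<lambda>z. 2 powr ((real N - 2) / 2) / (sqrt (real N * pi) * s powr (1 / real N))
                     * \<bar>z\<bar> powr (- ((real N + 1) / real N))
                     * exp (- (real N / (2 * (s * \<bar>z\<bar>) powr (2 / real N)))))"
      unfolding B cs divide_divide_eq_left .
  qed
qed

end
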